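(* Let $E$ be a real Banach lattice and let $S$ be a positive, bounded and irreducible $C_0$-semigroup on $E$ with generator $A$, and assume that $S$ is eventually norm continuous. Then precisely one of the following four situations occurs: (i) $\dim(\ker A')=0$; in this case $S(t)f\to0$ as $t\to\infty$ for each $f\in E$. (ii) $\dim(\ker A')=1$ and $\dim(\ker A)=1$; in this case there exist a quasi-interior point $u\in E_+$ and a strictly positive functional $\varphi\in E'$ such that $S(t)f\to\langle\varphi,f\rangle u$ as $t\to\infty$ for each $f\in E$. (iii) $\dim(\ker A')=1$ and $\dim(\ker A)=0$; in this case $S(t)$ does not converge strongly as $t\to\infty$. (iv) $\dim(\ker A')\ge2$; in this case $S(t)$ does not converge strongly as $t\to\infty$.
   Context: A $C_0$-semigroup is a map $S:(0,\infty)\to\mathcal{L}(E)$ with $S(s+t)=S(t)S(s)$, locally bounded near $0$, and $S(t)f\to f$ as $t\downarrow0$ for every $f$; its generator is $Af=\lim_{t\downarrow0}(S(t)f-f)/t$ on the set of $f$ where this limit exists, and $A'$ is its dual (adjoint) operator on $E'$. $S$ is bounded if $\sup_{t>0}\|S(t)\|<\infty$, positive if each $S(t)$ maps $E_+$ into $E_+$, and eventually norm continuous if there is $t_0\ge0$ such that $t\mapsto S(t)$ is continuous in operator norm on $(t_0,\infty)$. A positive semigroup is irreducible if for every $0<f\in E$ and $0<\varphi\in E'$ (where $0<x$ means $x\ge0,x\ne0$) there is $t>0$ with $\langle\varphi,S(t)f\rangle>0$. A vector $u\in E_+$ is a quasi-interior point if $\lim_{n\to\infty}v\wedge(nu)=v$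 for all $v\in E_+$; $\varphi\in E'$ is strictly positive if $\langle\varphi,f\rangle>0$ for all $0<f\in E$. *)

theory Defs
  imports "HOL-Analysis.Analysis"
begin

class banach_lattice = banach + ordered_real_vector + lattice +
  assumes norm_lattice: "sup x (- x) \<le> sup y (- y) \<Longrightarrow> norm x \<le> norm y"

definition C0_semigroup :: "(real \<Rightarrow> ('a::banach \<Rightarrow>\<^sub>L 'a)) \<Rightarrow> bool" where
  "C0_semigroup S \<longleftrightarrow>
     (\<forall>s>0. \<forall>t>0. S (s + t) = S t o\<^sub>L S s) \<and>
     (\<exists>\<delta>>0. \<exists>M. \<forall>t\<in>{0<..\<delta>}. norm (S t) \<le> M) \<and>
     (\<forall>f. ((\<lambda>t. S t f) \<longlongrightarrow> f) (at_right 0))"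

definition gen_dom :: "(real \<Rightarrow> ('a::banach \<Rightarrow>\<^sub>L 'a)) \<Rightarrow> 'a set" where
  "gen_dom S = {f. \<exists>g. ((\<lambda>t. (S t f - f) /\<^sub>R t) \<longlongrightarrow> g) (at_right 0)}"

definition gen :: "(real \<Rightarrow> ('a::banach \<Rightarrow>\<^sub>L 'a)) \<Rightarrow> 'a \<Rightarrow> 'a" where
  "gen S f = Lim (at_right 0) (\<lambda>t. (S t f - f) /\<^sub>R t)"

definition gen_ker :: "(real \<Rightarrow> ('a::banach \<Rightarrow>\<^sub>L 'a)) \<Rightarrow> 'a set" where
  "gen_ker S = {f \<in> gen_dom S. gen S f = 0}"

text \<open>The dual (adjoint) operator A' on E' (bounded linear functionals), as a relation (graph):
  phi in dom A' with A' phi = psi iff phi (A f) = psi f for all f in dom A.\<close>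
definition dual_gen_rel :: "(real \<Rightarrow> ('a::banach \<Rightarrow>\<^sub>L 'a)) \<Rightarrow> ('a \<Rightarrow>\<^sub>L real) \<Rightarrow> ('a \<Rightarrow>\<^sub>L real) \<Rightarrow> bool" where
  "dual_gen_rel S \<phi> \<psi> \<longleftrightarrow> (\<forall>f\<in>gen_dom S. \<phi> (gen S f) = \<psi> f)"

definition dual_gen_ker :: "(real \<Rightarrow> ('a::banach \<Rightarrow>\<^sub>L 'a)) \<Rightarrow> ('a \<Rightarrow>\<^sub>L real) set" where
  "dual_gen_ker S = {\<phi>. dual_gen_rel S \<phi> 0}"

definition edim :: "'a::real_vector set \<Rightarrow> enat" where
  "edim V = (if \<exists>B. finite B \<and> independent B \<and> span B = span V then enat (dim V) else \<infinity>)"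

definition bounded_semigroup :: "(real \<Rightarrow> ('a::banach \<Rightarrow>\<^sub>L 'a)) \<Rightarrow> bool" where
  "bounded_semigroup S \<longleftrightarrow> (\<exists>M. \<forall>t>0. norm (S t) \<le> M)"

definition positive_semigroup :: "(real \<Rightarrow> ('a::banach_lattice \<Rightarrow>\<^sub>L 'a)) \<Rightarrow> bool" where
  "positive_semigroup S \<longleftrightarrow> (\<forall>t>0. \<forall>f. 0 \<le> f \<longrightarrow> 0 \<le> S t f)"

definition pos_functional :: "('a::banach_lattice \<Rightarrow>\<^sub>L real) \<Rightarrow> bool" where
  "pos_functional \<phi> \<longleftrightarrow> (\<forall>f. 0 \<le> f \<longrightarrow> 0 \<le> \<phi> f)"

definition irreducible_semigroup :: "(real \<Rightarrow> ('a::banach_lattice \<Rightarrow>\<^sub>L 'a)) \<Rightarrow> bool" where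
  "irreducible_semigroup S \<longleftrightarrow>
     (\<forall>f \<phi>. 0 \<le> f \<and> f \<noteq> 0 \<and> pos_functional \<phi> \<and> \<phi> \<noteq> 0 \<longrightarrow> (\<exists>t>0. \<phi> (S t f) > 0))"

definition eventually_norm_continuous :: "(real \<Rightarrow> ('a::banach \<Rightarrow>\<^sub>L 'a)) \<Rightarrow> bool" where
  "eventually_norm_continuous S \<longleftrightarrow> (\<exists>t0\<ge>0. continuous_on {t0<..} S)"

definition quasi_interior :: "'a::banach_lattice \<Rightarrow> bool" where
  "quasi_interior u \<longleftrightarrow> 0 \<le> u \<and> (\<forall>v. 0 \<le> v \<longrightarrow> (\<lambda>n. inf v (real n *\<^sub>R u)) \<longlonglongrightarrow> v)"

definition strictly_pos_functional :: "('a::banach_lattice \<Rightarrow>\<^sub>L real) \<Rightarrow> bool" where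
  "strictly_pos_functional \<phi> \<longleftrightarrow> (\<forall>f. 0 \<le> f \<and> f \<noteq> 0 \<longrightarrow> \<phi> f > 0)"

definition strongly_convergent :: "(real \<Rightarrow> ('a::banach \<Rightarrow>\<^sub>L 'a)) \<Rightarrow> bool" where
  "strongly_convergent S \<longleftrightarrow> (\<forall>f. \<exists>g. ((\<lambda>t. S t f) \<longlongrightarrow> g) at_top)"

end

theory Submission
  imports Defs "HOL-Library.Lattice_Algebras"
begin

text \<open>
  The heart of the matter is that \<open>S t (S s f - f) \<rightarrow> 0\<close> for all \<open>f\<close> and \<open>s\<close>. Norm continuity
  provides arbitrarily small \<open>s\<close> for which \<open>T = S s\<close> satisfies \<open>\<parallel>T\<^bsup>m+1\<^esup> - T\<^bsup>m\<^esup>\<parallel> < 1\<close> for some \<open>m\<close>, and for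
  such positive power bounded \<open>T\<close> one has \<open>T\<^bsup>n\<^esup> (T f - f) \<rightarrow> 0\<close>. No spectral theory is needed: call a
  bounded sequence \<open>x\<close> null if \<open>\<parallel>(1/N) \<Sum>k<N. T\<^bsup>N-1-k\<^esup> \<bar>x k\<bar>\<parallel> \<rightarrow> 0\<close>. By telescoping, the bounded sequences with
  \<open>x (k+1) - T (x k)\<close> null form a vector lattice on which, modulo null sequences, \<open>T\<close> acts as the
  shift, that is, as an isometric lattice homomorphism at distance less than \<open>1\<close> from the
  identity. Such a homomorphism cannot map any positive element to a disjoint one, which
  forces it to be the identity.

  Hahn-Banach, applied to \<open>limsup \<parallel>(S t g)\<^sup>+\<parallel>\<close>, then produces a positive fixed functional not
  vanishing at \<open>g\<close> whenever \<open>S t g\<close> does not tend to \<open>0\<close>. By irreducibility such functionals are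
  strictly positive and positive fixed vectors are quasi-interior, so the fixed space is at most
  one-dimensional, and the four cases follow.
\<close>

section \<open>Banach lattices\<close>

\<comment> \<open>The average that defines null sequences has to meet two demands. For an orbit
  \<open>x k = T^k f\<close> all terms \<open>T^(N-1-k) (x k)\<close> coincide, so the average is
  \<open>T^(N-1) f\<close> itself and an estimate modulo null sequences turns back into a norm
  estimate. For the defect between \<open>T\<close> of a modulus and the next modulus, single terms
  are not controlled; only the accumulated sum is, since it telescopes to a bounded quantity, and
  division by \<open>N\<close> removes it.

  The gap is given for some power \<open>m\<close>, not for \<open>m = 0\<close>. Dropping or adding
  finitely many terms does not affect nullity, so the shift is isometric modulo null sequences, and
  a bound on the difference of its powers \<open>m + 1\<close> and \<open>m\<close> is a bound on
  its distance from the identity.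

  Neither an order unit nor band projections are available to locate where the shift moves an
  element. A slowly growing majorant \<open>w\<close> and a geometric ladder of levels of
  \<open>w\<close> take their place.\<close>
subclass (in banach_lattice) lattice_ab_group_add ..

definition modulus :: "'a::banach_lattice \<Rightarrow> 'a" where
  "modulus x = sup x (- x)"

lemma modulus_ge: "x \<le> modulus x" "- x \<le> modulus x"
  by (simp_all add: modulus_def)

lemma modulus_least: "x \<le> y \<Longrightarrow> - x \<le> y \<Longrightarrow> modulus x \<le> y"
  by (simp add: modulus_def)

lemma modulus_nonneg [simp]: "0 \<le> modulus x"
proof -
  have "0 = x + - x" by simp
  also have "\<dots> \<le> modulus x + modulus x"
    by (intro add_mono modulus_ge)
  finally show ?thesis by (simp only: zero_le_double_add_iff_zero_le_single_add)
qed

lemma modulus_of_nonneg [simp]: "0 \<le> x \<Longrightarrow> modulus x = x"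
  by (auto simp: modulus_def intro!: sup_absorb1 order_trans[of "- x" 0 x])

lemma modulus_minus [simp]: "modulus (- x) = modulus x"
  by (simp add: modulus_def sup_commute)

lemma modulus_minus_commute: "modulus (x - y) = modulus (y - x)"
  by (metis minus_diff_eq modulus_minus)

lemma modulus_triangle: "modulus (x + y) \<le> modulus x + modulus y"
proof (rule modulus_least)
  show "- (x + y) \<le> modulus x + modulus y"
    using add_mono[OF modulus_ge(2)[of x] modulus_ge(2)[of y]] by simp
qed (intro add_mono modulus_ge)

lemma norm_mono_modulus: "modulus x \<le> modulus y \<Longrightarrow> norm x \<le> norm y"
  by (simp add: modulus_def norm_lattice)

lemma norm_modulus [simp]: "norm (modulus x) = norm x"
  by (intro antisym norm_mono_modulus) simp_all

lemma norm_mono_nonneg: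
  fixes x y :: "'a::banach_lattice"
  shows "0 \<le> x \<Longrightarrow> x \<le> y \<Longrightarrow> norm x \<le> norm y"
  by (rule norm_mono_modulus) (simp add: order_trans[of 0 x y])

lemma norm_mono_modulus_le: "modulus x \<le> y \<Longrightarrow> norm x \<le> norm y"
  using norm_mono_nonneg[of "modulus x" y] by simp

lemma modulus_scaleR: "modulus (r *\<^sub>R x) \<le> \<bar>r\<bar> *\<^sub>R modulus x"
proof (cases "r \<ge> 0")
  case True
  have "r *\<^sub>R x \<le> r *\<^sub>R modulus x" "r *\<^sub>R (- x) \<le> r *\<^sub>R modulus x"
    by (intro scaleR_left_mono modulus_ge True)+
  with True show ?thesis by (intro modulus_least) auto
next
  case False
  have "(-r) *\<^sub>R x \<le> (-r) *\<^sub>R modulus x" "(-r) *\<^sub>R (- x) \<le> (-r) *\<^sub>R modulus x"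
    using False by (intro scaleR_left_mono modulus_ge; simp)+
  with False show ?thesis by (intro modulus_least) auto
qed

lemma pprt_least: "x \<le> y \<Longrightarrow> 0 \<le> y \<Longrightarrow> pprt x \<le> y"
  by (simp add: pprt_def)

lemma le_pprt: "x \<le> pprt x"
  by (simp add: pprt_def)

lemma pprt_le_modulus: "pprt x \<le> modulus x"
  by (intro pprt_least modulus_ge modulus_nonneg)

lemma pprt_add: "pprt (x + y) \<le> pprt x + pprt y"
  by (intro pprt_least add_mono le_pprt add_nonneg_nonneg zero_le_pprt)

lemma norm_pprt_le:
  fixes x :: "'a::banach_lattice"
  shows "norm (pprt x) \<le> norm x"
  using norm_mono_nonneg[OF zero_le_pprt pprt_le_modulus, of x] by simp

lemma pprt_scaleR:
  fixes x :: "'a::banach_lattice"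
  shows "0 \<le> r \<Longrightarrow> pprt (r *\<^sub>R x) = r *\<^sub>R pprt x"
proof (cases "r = 0")
  case False
  assume "0 \<le> r"
  with False have r: "0 < r" by simp
  have *: "pprt (r *\<^sub>R x) \<le> r *\<^sub>R pprt x" if "0 < r" for r and x :: 'a
    using that by (intro pprt_least scaleR_left_mono le_pprt scaleR_nonneg_nonneg zero_le_pprt) auto
  have "pprt (inverse r *\<^sub>R (r *\<^sub>R x)) \<le> inverse r *\<^sub>R pprt (r *\<^sub>R x)"
    using r by (intro *) simp
  then have "r *\<^sub>R pprt x \<le> r *\<^sub>R (inverse r *\<^sub>R pprt (r *\<^sub>R x))"
    using r by (intro scaleR_left_mono) auto
  with r *[OF r, of x] show ?thesis by (intro antisym) auto
qed simp

lemma pprt_diff_eq: "pprt x - pprt (- x) = x"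
  using prts[of x] by (simp add: pprt_neg)

text \<open>For the second inequality the sum of the two parts is rewritten as twice
  \<open>pprt x\<close> minus \<open>x\<close>; doubling inside the positive part then allows a
  direct comparison with \<open>modulus x + x\<close>.\<close>

lemma modulus_eq_pprt: "modulus x = pprt x + pprt (- x)"
proof (rule antisym)
  show "modulus x \<le> pprt x + pprt (- x)"
    using le_pprt[of x] le_pprt[of "- x"]
    by (intro modulus_least) (auto intro: add_increasing add_increasing2)
  have "pprt x + pprt (- x) = pprt x + (pprt x - x)"
    using pprt_diff_eq[of x] by (metis diff_diff_eq2 add_diff_cancel_left')
  also have "\<dots> \<le> modulus x"
  proof -
    have "pprt x + pprt x = pprt (x + x)" using pprt_scaleR[of 2 x] by (simp add: scaleR_2)
    also have "\<dots> \<le> modulus x + x"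
      
    proof (rule pprt_least)
      show "x + x \<le> modulus x + x" by (intro add_right_mono modulus_ge)
      show "0 \<le> modulus x + x" using add_right_mono[OF modulus_ge(2)[of x], of x] by simp
    qed
    finally show ?thesis by (simp add: algebra_simps)
  qed
  finally show "pprt x + pprt (- x) \<le> modulus x" .
qed

lemma pprt_eq_half:
  fixes x :: "'a::banach_lattice"
  shows "pprt x = (1/2) *\<^sub>R (x + modulus x)"
proof -
  have "x + modulus x = (pprt x - pprt (- x)) + (pprt x + pprt (- x))"
    by (simp only: pprt_diff_eq modulus_eq_pprt[symmetric])
  also have "\<dots> = 2 *\<^sub>R pprt x" by (simp add: scaleR_2)
  finally show ?thesis by simp
qed

lemma pprt_disjoint: "inf (pprt x) (pprt (- x)) = 0"
proof -
  have "inf (pprt x) (pprt (- x)) = pprt (- x) + inf (pprt x - pprt (- x)) 0"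
    by (simp add: add_inf_distrib_left)
  also have "\<dots> = pprt (- x) + nprt x"
    by (simp only: pprt_diff_eq nprt_def)
  also have "\<dots> = 0" by (simp add: pprt_neg)
  finally show ?thesis .
qed

text \<open>Reduces meets to positive parts, and identifies the error in the definition of
  quasi-interior points as \<open>pprt (v - n *\<^sub>R u)\<close>.\<close>

lemma diff_inf_eq_pprt: "x - inf x y = pprt (x - y)"
  by (simp add: diff_inf_eq_sup pprt_def add_sup_distrib_left sup_commute)

lemma inf_add_le:
  fixes a b c :: "'a::banach_lattice"
  assumes "0 \<le> a" "0 \<le> b" "0 \<le> c"
  shows "inf a (b + c) \<le> inf a b + inf a c"
proof -
  have "inf a (b + c) - inf a b \<le> inf a c"
  proof (rule le_infI)
    have "inf a (b + c) \<le> a" by simp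
    also have "a \<le> a + inf a b" using assms by simp
    finally show "inf a (b + c) - inf a b \<le> a" by (simp only: diff_le_eq)
    have "inf a (b + c) \<le> inf (a + c) (b + c)"
      using assms by (intro inf_mono) auto
    also have "\<dots> = inf a b + c" by (simp add: add_inf_distrib_right)
    finally show "inf a (b + c) - inf a b \<le> c" by (metis diff_le_eq add.commute)
  qed
  then show ?thesis by (metis diff_le_eq add.commute)
qed

lemma inf_scaleR_le:
  fixes a b :: "'a::banach_lattice"
  assumes "0 \<le> a" "0 \<le> b" "1 \<le> r"
  shows "inf a (r *\<^sub>R b) \<le> r *\<^sub>R inf a b"
proof -
  have "inverse r *\<^sub>R inf a (r *\<^sub>R b) \<le> inf a b"
  proof (rule le_infI)
    have "inverse r *\<^sub>R inf a (r *\<^sub>R b) \<le> 1 *\<^sub>R inf a (r *\<^sub>R b)"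
      using assms by (intro scaleR_right_mono le_infI scaleR_nonneg_nonneg) (auto simp: divide_simps)
    also have "\<dots> \<le> a" by simp
    finally show "inverse r *\<^sub>R inf a (r *\<^sub>R b) \<le> a" .
    have "inverse r *\<^sub>R inf a (r *\<^sub>R b) \<le> inverse r *\<^sub>R (r *\<^sub>R b)"
      using assms by (intro scaleR_left_mono) auto
    then show "inverse r *\<^sub>R inf a (r *\<^sub>R b) \<le> b" using assms by simp
  qed
  then have "r *\<^sub>R (inverse r *\<^sub>R inf a (r *\<^sub>R b)) \<le> r *\<^sub>R inf a b"
    using assms by (intro scaleR_left_mono) auto
  then show ?thesis using assms by simp
qed

lemma modulus_diff_disjoint:
  fixes a b :: "'a::banach_lattice"
  assumes "inf a b = 0"
  shows "modulus (a - b) = a + b"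
proof -
  have "pprt (a - b) = a" "pprt (b - a) = b"
    using diff_inf_eq_pprt[of a b] diff_inf_eq_pprt[of b a] assms by (simp_all add: inf_commute)
  then show ?thesis by (simp add: modulus_eq_pprt)
qed

lemma pprt_diff_le: "pprt x - pprt y \<le> pprt (x - y)"
proof -
  have "pprt (y + (x - y)) \<le> pprt y + pprt (x - y)" by (rule pprt_add)
  then show ?thesis by (simp only: diff_le_eq add.commute[of "pprt (x - y)"] add_diff_cancel_left' diff_add_cancel add_diff_eq)
qed

lemma norm_pprt_diff_le: "norm (pprt x - pprt y) \<le> norm (x - y)"
  for x y :: "'a::banach_lattice"
proof (rule norm_mono_modulus, rule modulus_least)
  show "pprt x - pprt y \<le> modulus (x - y)"
    by (rule order_trans[OF pprt_diff_le pprt_le_modulus])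
  have "pprt y - pprt x \<le> modulus (y - x)"
    by (rule order_trans[OF pprt_diff_le pprt_le_modulus])
  then show "- (pprt x - pprt y) \<le> modulus (x - y)"
    by (simp only: minus_diff_eq modulus_minus_commute[of x y])
qed

lemma tendsto_pprt:
  fixes f :: "'b \<Rightarrow> 'a::banach_lattice"
  assumes "(f \<longlongrightarrow> l) F"
  shows "((\<lambda>x. pprt (f x)) \<longlongrightarrow> pprt l) F"
proof -
  have "((\<lambda>x. norm (f x - l)) \<longlongrightarrow> 0) F"
    using assms by (simp only: tendsto_norm_zero_iff LIM_zero_iff)
  then have "((\<lambda>x. pprt (f x) - pprt l) \<longlongrightarrow> 0) F"
    by (rule Lim_null_comparison[rotated]) (rule always_eventually, rule allI, rule norm_pprt_diff_le)
  then show ?thesis by (simp only: LIM_zero_iff)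
qed

text \<open>The cone is the zero set of the continuous map sending \<open>x\<close> to
  \<open>pprt (- x)\<close>. Closedness lets positivity pass to sums of series.\<close>

lemma closed_nonneg: "closed {x :: 'a::banach_lattice. 0 \<le> x}"
proof -
  have eq: "0 \<le> x \<longleftrightarrow> pprt (- x) = 0" for x :: 'a
    by (simp only: le_zero_iff_zero_pprt[symmetric] neg_le_0_iff_le)
  have "continuous_on UNIV (\<lambda>x::'a. pprt (- x))"
    unfolding continuous_on_def by (intro ballI tendsto_pprt tendsto_minus tendsto_ident_at)
  then have "closed {x::'a. pprt (- x) = 0}"
    by (intro closed_Collect_eq continuous_on_const)
  then show ?thesis by (simp only: eq)
qed

lemma suminf_nonneg_lattice:
  fixes f :: "nat \<Rightarrow> 'a::banach_lattice"
  assumes "summable f" "\<And>n. 0 \<le> f n"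
  shows "0 \<le> suminf f"
proof -
  have "(\<lambda>n. sum f {..<n}) \<longlonglongrightarrow> suminf f" by (rule summable_LIMSEQ[OF assms(1)])
  then have "suminf f \<in> {x. 0 \<le> x}"
    by (rule Lim_in_closed_set[OF closed_nonneg, rotated -1]) (auto simp: assms(2) intro!: always_eventually sum_nonneg)
  then show ?thesis by simp
qed

section \<open>Hahn-Banach\<close>

definition sublinear :: "('a::real_vector \<Rightarrow> real) \<Rightarrow> bool" where
  "sublinear p \<longleftrightarrow> (\<forall>x y. p (x + y) \<le> p x + p y) \<and> (\<forall>r>0. \<forall>x. p (r *\<^sub>R x) = r * p x)"

lemma sublinearD:
  assumes "sublinear p"
  shows "p (x + y) \<le> p x + p y" "0 < r \<Longrightarrow> p (r *\<^sub>R x) = r * p x" "p 0 = 0" "- p (- x) \<le> p x"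
proof -
  show *: "p (x + y) \<le> p x + p y" "0 < r \<Longrightarrow> p (r *\<^sub>R x) = r * p x" for x y r
    using assms by (auto simp: sublinear_def)
  show 0: "p 0 = 0" using *(2)[of 2 0] by simp
  show "- p (- x) \<le> p x" using *(1)[of x "- x"] 0 by simp
qed

text \<open>The infimum trades multiples of \<open>y\<close> against their value under
  \<open>p\<close>. The last property gives \<open>q (- y) \<le> - p y\<close>. The construction
  serves twice: it makes minimal functionals additive, and it pins down the value at a prescribed
  vector.\<close>

lemma sublinear_shrink:
  fixes y :: "'a::real_vector"
  assumes p: "sublinear p"
  defines "q \<equiv> \<lambda>x. INF t\<in>{0..}. p (x + t *\<^sub>R y) - t * p y"
  shows "sublinear q" "q x \<le> p x" "q x \<le> p (x + y) - p y"
proof -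
  note pD = sublinearD[OF p]
  have scale: "p (t *\<^sub>R z) = t * p z" if "0 \<le> t" for t z
    using that pD(2)[of t z] pD(3) by (cases "t = 0") auto
  have bdd: "bdd_below ((\<lambda>t. p (x + t *\<^sub>R y) - t * p y) ` {0..})" for x
  proof (rule bdd_belowI2)
    fix t :: real assume t: "t \<in> {0..}"
    have "p (t *\<^sub>R y) \<le> p (x + t *\<^sub>R y) + p (- x)"
      using pD(1)[of "x + t *\<^sub>R y" "- x"] by simp
    with t scale[of t y] show "- p (- x) \<le> p (x + t *\<^sub>R y) - t * p y" by simp
  qed
  have le: "q x \<le> p (x + t *\<^sub>R y) - t * p y" if "0 \<le> t" for x t
    unfolding q_def using bdd that by (intro cINF_lower) auto
  have ge: "c \<le> q x" if "\<And>t. 0 \<le> t \<Longrightarrow> c \<le> p (x + t *\<^sub>R y) - t * p y" for c x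
    unfolding q_def using that by (intro cINF_greatest) auto
  show "q x \<le> p x" using le[of 0 x] by simp
  show "q x \<le> p (x + y) - p y" using le[of 1 x] by simp
  have add: "q (a + b) \<le> q a + q b" for a b
  proof -
    have "q (a + b) - (p (b + s *\<^sub>R y) - s * p y) \<le> q a" if s: "0 \<le> s" for s
    proof (rule ge)
      fix t :: real assume t: "0 \<le> t"
      have "q (a + b) \<le> p (a + b + (t + s) *\<^sub>R y) - (t + s) * p y"
        using s t by (intro le) auto
      also have "\<dots> \<le> p (a + t *\<^sub>R y) + p (b + s *\<^sub>R y) - (t + s) * p y"
        using pD(1)[of "a + t *\<^sub>R y" "b + s *\<^sub>R y"] by (simp add: algebra_simps)
      finally show "q (a + b) - (p (b + s *\<^sub>R y) - s * p y) \<le> p (a + t *\<^sub>R y) - t * p y"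
        by (simp add: algebra_simps)
    qed
    then have "q (a + b) - q a \<le> q b"
      by (intro ge) (simp add: algebra_simps)
    then show ?thesis by simp
  qed
  have scale_le: "q (r *\<^sub>R a) \<le> r * q a" if r: "0 < r" for r a
  proof -
    have "q (r *\<^sub>R a) / r \<le> q a"
    proof (rule ge)
      fix t :: real assume t: "0 \<le> t"
      have "q (r *\<^sub>R a) \<le> p (r *\<^sub>R a + (r * t) *\<^sub>R y) - (r * t) * p y"
        using r t by (intro le) auto
      also have "\<dots> = r * (p (a + t *\<^sub>R y) - t * p y)"
        using pD(2)[OF r, of "a + t *\<^sub>R y"] by (simp add: algebra_simps)
      finally show "q (r *\<^sub>R a) / r \<le> p (a + t *\<^sub>R y) - t * p y"
        using r by (simp add: divide_simps mult.commute)
    qed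
    then show ?thesis using r by (simp add: divide_simps mult.commute)
  qed
  have "q (r *\<^sub>R a) = r * q a" if r: "0 < r" for r a
  proof -
    have "q (inverse r *\<^sub>R (r *\<^sub>R a)) \<le> inverse r * q (r *\<^sub>R a)"
      using r by (intro scale_le) auto
    then have "r * q a \<le> q (r *\<^sub>R a)" using r by (simp add: field_simps)
    with scale_le[OF r, of a] show ?thesis by simp
  qed
  with add show "sublinear q" by (auto simp: sublinear_def)
qed

text \<open>A pointwise minimal sublinear functional is linear, because it cannot be shrunk
  in any direction.\<close>

lemma minimal_sublinear_linear:
  assumes q: "sublinear q" and min: "\<And>q'. sublinear q' \<Longrightarrow> q' \<le> q \<Longrightarrow> q' = q"
  shows "linear q"
proof -
  have add: "q (x + y) = q x + q y" for x y
  proof -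
    define q' where "q' = (\<lambda>x. INF t\<in>{0..}. q (x + t *\<^sub>R y) - t * q y)"
    have "q' = q"
      using sublinear_shrink(1,2)[OF q, where y = y] unfolding q'_def by (intro min le_funI)
    moreover have "q' x \<le> q (x + y) - q y"
      using sublinear_shrink(3)[OF q, where y = y] unfolding q'_def .
    ultimately show ?thesis using sublinearD(1)[OF q, of x y] by simp
  qed
  have neg: "q (- x) = - q x" for x
    using add[of x "- x"] sublinearD(3)[OF q] by simp
  have "q (r *\<^sub>R x) = r * q x" for r x
  proof (cases r "0 :: real" rule: linorder_cases)
    case less
    then have "q ((- r) *\<^sub>R x) = (- r) * q x" by (intro sublinearD(2)[OF q]) simp
    then show ?thesis using neg[of "r *\<^sub>R x"] by simp
  qed (use sublinearD(2,3)[OF q] in auto)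
  with add show ?thesis by (intro linearI) simp_all
qed

text \<open>Zorn's lemma for the reversed order; a chain is bounded by its pointwise infimum. This
  is finite because every member stays above \<open>- p (- x)\<close>, and subadditive because two
  members of a chain can be replaced by the smaller one.\<close>

lemma exists_minimal_sublinear:
  assumes p: "sublinear p"
  shows "\<exists>q. sublinear q \<and> q \<le> p \<and> (\<forall>q'. sublinear q' \<longrightarrow> q' \<le> q \<longrightarrow> q' = q)"
proof -
  define A where "A = {q. sublinear q \<and> q \<le> p}"
  have "\<exists>m\<in>A. \<forall>a\<in>A. a \<le> m \<longrightarrow> a = m"
  proof (rule predicate_Zorn[where P = "\<lambda>a b. b \<le> a"])
    show "partial_order_on A (relation_of (\<lambda>a b. b \<le> a) A)"
      by (rule partial_order_on_relation_ofI) auto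
    fix C assume C: "C \<in> Chains (relation_of (\<lambda>a b. b \<le> a) A)"
    have CA: "\<And>q. q \<in> C \<Longrightarrow> q \<in> A" and
      tot: "\<And>a b. a \<in> C \<Longrightarrow> b \<in> C \<Longrightarrow> a \<le> b \<or> b \<le> a"
      using C by (auto simp: Chains_def relation_of_def)
    show "\<exists>u\<in>A. \<forall>a\<in>C. u \<le> a"
    proof (cases "C = {}")
      case True
      then show ?thesis using p by (auto simp: A_def)
    next
      case ne: False
      define u where "u = (\<lambda>x. INF q\<in>C. q x)"
      have bdd: "bdd_below ((\<lambda>q. q x) ` C)" for x
      proof (rule bdd_belowI2)
        fix q assume "q \<in> C"
        then have q: "sublinear q" "q \<le> p" using CA by (auto simp: A_def)
        have "- p (- x) \<le> - q (- x)" using q(2) by (simp add: le_fun_def)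
        also have "\<dots> \<le> q x" by (rule sublinearD(4)[OF q(1)])
        finally show "- p (- x) \<le> q x" .
      qed
      have le: "u x \<le> q x" if "q \<in> C" for q x
        unfolding u_def using bdd that by (intro cINF_lower) auto
      have ge: "c \<le> u x" if "\<And>q. q \<in> C \<Longrightarrow> c \<le> q x" for c x
        unfolding u_def using that ne by (intro cINF_greatest) auto
      have add: "u (x + y) \<le> u x + u y" for x y
      proof -
        have "u (x + y) - q y \<le> u x" if q: "q \<in> C" for q
        proof (rule ge)
          fix q' assume q': "q' \<in> C"
          obtain r where r: "r \<in> C" "r \<le> q" "r \<le> q'"
            using tot[OF q q'] q q' by blast
          have "u (x + y) \<le> r (x + y)" by (rule le[OF r(1)])
          also have "\<dots> \<le> r x + r y" using CA[OF r(1)] by (auto simp: A_def intro: sublinearD)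
          also have "\<dots> \<le> q' x + q y" using r(2,3) by (intro add_mono) (simp_all add: le_fun_def)
          finally show "u (x + y) - q y \<le> q' x" by simp
        qed
        then have "u (x + y) - u x \<le> u y" by (intro ge) (simp add: algebra_simps)
        then show ?thesis by simp
      qed
      have scale: "u (r *\<^sub>R x) = r * u x" if r: "0 < r" for r x
      proof (rule antisym)
        have eq: "q (r *\<^sub>R x) = r * q x" if "q \<in> C" for q
          using CA[OF that] r by (auto simp: A_def intro: sublinearD)
        have "u (r *\<^sub>R x) / r \<le> u x"
          using le[of _ "r *\<^sub>R x"] eq r by (intro ge) (auto simp: divide_simps mult.commute)
        then show "u (r *\<^sub>R x) \<le> r * u x" using r by (simp add: divide_simps mult.commute)
        show "r * u x \<le> u (r *\<^sub>R x)"
          using le[of _ x] r by (intro ge) (simp add: eq)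
      qed
      obtain q0 where q0: "q0 \<in> C" using ne by auto
      have "u \<le> q0" using le[OF q0] by (simp add: le_fun_def)
      moreover have "q0 \<le> p" using CA[OF q0] by (simp add: A_def)
      ultimately have "u \<le> p" by (rule order_trans)
      then show ?thesis using add scale le
        by (intro bexI[of _ u]) (simp_all add: A_def sublinear_def le_fun_def)
    qed
  qed
  then obtain m where "m \<in> A" and min: "\<And>a. a \<in> A \<Longrightarrow> a \<le> m \<Longrightarrow> a = m" by blast
  have "q' = m" if "sublinear q'" "q' \<le> m" for q'
    using that \<open>m \<in> A\<close> order_trans[of q' m p] by (intro min) (simp_all add: A_def)
  with \<open>m \<in> A\<close> show ?thesis by (auto simp: A_def)
qed

theorem Hahn_Banach_sublinear:
  assumes p: "sublinear p"
  obtains \<psi> where "linear \<psi>" "\<And>x. \<psi> x \<le> p x" "\<psi> x0 = p x0"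
proof -
  \<comment> \<open>Shrinking in direction \<open>x0\<close> beforehand forces every functional
    below \<open>p'\<close> to be at most \<open>- p x0\<close> at \<open>- x0\<close>; for a linear
    one this means at least \<open>p x0\<close> at \<open>x0\<close>.\<close>
  define p' where "p' = (\<lambda>x. INF t\<in>{0..}. p (x + t *\<^sub>R x0) - t * p x0)"
  have p': "sublinear p'" "p' x \<le> p x" "p' x \<le> p (x + x0) - p x0" for x
    unfolding p'_def by (rule sublinear_shrink[OF p])+
  obtain q where q: "sublinear q" "q \<le> p'" "\<And>q'. sublinear q' \<Longrightarrow> q' \<le> q \<Longrightarrow> q' = q"
    using exists_minimal_sublinear[OF p'(1)] by blast
  have lin: "linear q" by (rule minimal_sublinear_linear) (use q in auto)
  have le: "q x \<le> p x" for x
    using le_funD[OF q(2), of x] p'(2)[of x] by (rule order_trans)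
  have "q (- x0) \<le> p (- x0 + x0) - p x0"
    using le_funD[OF q(2), of "- x0"] p'(3)[of "- x0"] by (rule order_trans)
  then have "p x0 \<le> q x0" using linear_neg[OF lin, of x0] sublinearD(3)[OF p] by simp
  then show ?thesis using that[OF lin le] le[of x0] by simp
qed

text \<open>The bound used at both \<open>x\<close> and \<open>- x\<close> controls the absolute
  value, so the linear minorant is continuous.\<close>

corollary Hahn_Banach_bounded:
  fixes p :: "'a::real_normed_vector \<Rightarrow> real"
  assumes p: "sublinear p" and bound: "\<And>x. p x \<le> C * norm x"
  obtains \<psi> :: "'a \<Rightarrow>\<^sub>L real" where "\<And>x. \<psi> x \<le> p x" "\<psi> x0 = p x0"
proof -
  obtain q where q: "linear q" "\<And>x. q x \<le> p x" "q x0 = p x0"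
    using Hahn_Banach_sublinear[OF p] by metis
  have "\<bar>q x\<bar> \<le> norm x * C" for x
    using order_trans[OF q(2) bound, of x] order_trans[OF q(2) bound, of "- x"]
    by (simp add: linear_neg[OF q(1)] abs_le_iff mult.commute)
  then have "bounded_linear q"
    using q(1) by (intro bounded_linear_intro[where K = C]) (auto simp: linear_add linear_scale)
  then show ?thesis using that[of "Blinfun q"] q by (simp add: bounded_linear_Blinfun_apply)
qed

section \<open>Power bounded positive operators\<close>

locale power_bounded_positive =
  fixes T :: "'a::banach_lattice \<Rightarrow> 'a" and M :: real
  assumes bounded_linear_T: "bounded_linear T"
    and pos_T: "0 \<le> f \<Longrightarrow> 0 \<le> T f"
    and power_bound: "norm ((T ^^ n) f) \<le> M * norm f"
    and M_nonneg: "0 \<le> M"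
begin

lemma T_add: "T (x + y) = T x + T y" and T_diff: "T (x - y) = T x - T y"
  and T_scaleR: "T (r *\<^sub>R x) = r *\<^sub>R T x" and T_zero: "T 0 = 0" and T_minus: "T (- x) = - T x"
  using bounded_linear_T
  by (simp_all add: linear_simps)

lemma T_mono: "x \<le> y \<Longrightarrow> T x \<le> T y"
  using pos_T[of "y - x"] by (simp add: T_diff)

lemma modulus_T: "modulus (T x) \<le> T (modulus x)"
proof (rule modulus_least)
  show "T x \<le> T (modulus x)" by (intro T_mono modulus_ge)
  have "T (- x) \<le> T (modulus x)" by (intro T_mono modulus_ge)
  then show "- T x \<le> T (modulus x)" by (simp only: T_minus)
qed

lemma bounded_linear_power: "bounded_linear (T ^^ n)"
proof (induction n)
  case (Suc n)
  then show ?case using bounded_linear_compose[OF bounded_linear_T Suc] by (simp add: o_def)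
qed (simp add: id_def)

lemma pos_power: "0 \<le> f \<Longrightarrow> 0 \<le> (T ^^ n) f"
  by (induction n) (simp_all add: pos_T)

lemma norm_T: "norm (T f) \<le> M * norm f"
  using power_bound[of 1 f] by simp

section \<open>Accumulated sums of \<open>T^(N-1-k) (x k)\<close> in Horner form\<close>

primrec acc :: "(nat \<Rightarrow> 'a) \<Rightarrow> nat \<Rightarrow> 'a" where
  "acc x 0 = 0"
| "acc x (Suc N) = T (acc x N) + x N"

lemma acc_add: "acc (\<lambda>k. x k + y k) N = acc x N + acc y N"
  by (induction N) (simp_all add: T_add)

lemma acc_scaleR: "acc (\<lambda>k. r *\<^sub>R x k) N = r *\<^sub>R acc x N"
  by (induction N) (simp_all add: T_scaleR scaleR_add_right)

lemma acc_T: "acc (\<lambda>k. T (x k)) N = T (acc x N)"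
  by (induction N) (simp_all add: T_add T_zero)

lemma acc_nonneg: "(\<And>k. 0 \<le> x k) \<Longrightarrow> 0 \<le> acc x N"
  by (induction N) (simp_all add: pos_T)

lemma acc_mono: "(\<And>k. x k \<le> y k) \<Longrightarrow> acc x N \<le> acc y N"
  by (induction N) (simp_all add: T_mono add_mono)

text \<open>Only the two end terms survive. For bounded \<open>x\<close> both are bounded, so such a
  defect disappears after division by \<open>N\<close>.\<close>

lemma acc_telescope: "acc (\<lambda>k. T (x k) - x (Suc k)) N = (T ^^ N) (x 0) - x N"
  by (induction N) (simp_all add: T_diff)

lemma acc_shift: "acc x (Suc N) = acc (\<lambda>k. x (Suc k)) N + (T ^^ N) (x 0)"
  by (induction N) (simp_all add: T_add T_zero)

lemma acc_orbit: "acc (\<lambda>k. (T ^^ k) f) (Suc N) = real (Suc N) *\<^sub>R (T ^^ N) f"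
  by (induction N) (simp_all add: T_add T_scaleR T_zero scaleR_add_left scaleR_2)

lemma norm_acc_le:
  assumes "\<And>k. norm (x k) \<le> C"
  shows "norm (acc x N) \<le> real N * (M * C)"
proof -
  \<comment> \<open>The extra power \<open>T^j\<close> absorbs the \<open>T\<close> of the recursion
    into \<open>j\<close>; estimating \<open>T\<close> once per step would multiply up powers of
    \<open>M\<close>.\<close>
  have "norm ((T ^^ j) (acc x N)) \<le> real N * (M * C)" for j
  proof (induction N arbitrary: j)
    case 0
    then show ?case using linear_simps(3)[OF bounded_linear_power[of j]] by simp
  next
    case (Suc N)
    have "(T ^^ j) (acc x (Suc N)) = (T ^^ Suc j) (acc x N) + (T ^^ j) (x N)"
      using linear_simps(1)[OF bounded_linear_power[of j], of "T (acc x N)" "x N"]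
      by (simp add: funpow_swap1)
    also have "norm \<dots> \<le> real N * (M * C) + M * C"
    proof (rule order_trans[OF norm_triangle_ineq], rule add_mono[OF Suc])
      show "norm ((T ^^ j) (x N)) \<le> M * C"
        using power_bound[of j "x N"] mult_left_mono[OF assms[of N] M_nonneg] by linarith
    qed
    finally show ?case by (simp add: algebra_simps)
  qed
  from this[of 0] show ?thesis by simp
qed

section \<open>Null sequences\<close>

definition null :: "(nat \<Rightarrow> 'a) \<Rightarrow> bool" where
  "null x \<longleftrightarrow> (\<lambda>N. norm (acc (\<lambda>k. modulus (x k)) N) / real N) \<longlonglongrightarrow> 0"

lemma nullI:
  assumes lim: "(\<lambda>N. norm (acc y N) / real N) \<longlonglongrightarrow> 0" and le: "\<And>k. modulus (x k) \<le> y k"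
  shows "null x"
  unfolding null_def
proof (rule Lim_null_comparison[OF always_eventually lim], rule allI)
  fix N
  have "norm (acc (\<lambda>k. modulus (x k)) N) \<le> norm (acc y N)"
    by (intro norm_mono_nonneg acc_nonneg acc_mono le modulus_nonneg)
  then show "norm (norm (acc (\<lambda>k. modulus (x k)) N) / real N) \<le> norm (acc y N) / real N"
    by (simp add: divide_right_mono)
qed

lemma null_mono: "null y \<Longrightarrow> (\<And>k. modulus (x k) \<le> modulus (y k)) \<Longrightarrow> null x"
  unfolding null_def[of y] by (rule nullI)

lemma null_mono': "null y \<Longrightarrow> (\<And>k. 0 \<le> x k) \<Longrightarrow> (\<And>k. x k \<le> y k) \<Longrightarrow> null x"
  by (rule null_mono[of y]) (simp_all add: order_trans[OF _ modulus_ge(1)])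

lemma null_zero: "null (\<lambda>k. 0)"
proof -
  have "acc (\<lambda>k. 0) N = 0" for N by (induction N) (simp_all add: T_zero)
  then show ?thesis by (simp add: null_def)
qed

lemma null_add:
  assumes "null x" "null y"
  shows "null (\<lambda>k. x k + y k)"
proof (rule nullI)
  have "(\<lambda>N. norm (acc (\<lambda>k. modulus (x k)) N) / real N + norm (acc (\<lambda>k. modulus (y k)) N) / real N)
      \<longlonglongrightarrow> 0"
    using tendsto_add[OF assms[unfolded null_def]] by simp
  then show "(\<lambda>N. norm (acc (\<lambda>k. modulus (x k) + modulus (y k)) N) / real N) \<longlonglongrightarrow> 0"
    by (rule Lim_null_comparison[rotated])
      (simp add: acc_add divide_right_mono norm_triangle_ineq flip: add_divide_distrib)
qed (rule modulus_triangle)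

lemma null_scaleR:
  assumes "null x"
  shows "null (\<lambda>k. r *\<^sub>R x k)"
proof (rule nullI)
  have "(\<lambda>N. \<bar>r\<bar> * (norm (acc (\<lambda>k. modulus (x k)) N) / real N)) \<longlonglongrightarrow> 0"
    using tendsto_mult_right_zero[OF assms[unfolded null_def]] .
  then show "(\<lambda>N. norm (acc (\<lambda>k. \<bar>r\<bar> *\<^sub>R modulus (x k)) N) / real N) \<longlonglongrightarrow> 0"
    by (simp add: acc_scaleR)
qed (rule modulus_scaleR)

lemma null_minus: "null x \<Longrightarrow> null (\<lambda>k. - x k)"
  by (simp add: null_def)

lemma null_diff: "null x \<Longrightarrow> null y \<Longrightarrow> null (\<lambda>k. x k - y k)"
  using null_add[of x "\<lambda>k. - y k"] null_minus[of y] by simp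

lemma null_sum: "(\<And>j. j \<in> A \<Longrightarrow> null (x j)) \<Longrightarrow> null (\<lambda>k. \<Sum>j\<in>A. x j k)"
  by (induction A rule: infinite_finite_induct) (simp_all add: null_zero null_add)

lemma null_T:
  assumes "null x"
  shows "null (\<lambda>k. T (x k))"
proof (rule nullI)
  have "(\<lambda>N. M * (norm (acc (\<lambda>k. modulus (x k)) N) / real N)) \<longlonglongrightarrow> 0"
    using tendsto_mult_right_zero[OF assms[unfolded null_def]] .
  then show "(\<lambda>N. norm (acc (\<lambda>k. T (modulus (x k))) N) / real N) \<longlonglongrightarrow> 0"
    by (rule Lim_null_comparison[rotated]) (simp add: acc_T divide_right_mono norm_T)
qed (rule modulus_T)

lemma null_power: "null x \<Longrightarrow> null (\<lambda>k. (T ^^ m) (x k))"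
  by (induction m) (simp_all add: null_T)

lemma real_quotient_tendsto: "(\<lambda>N. real (Suc N) / real N) \<longlonglongrightarrow> 1"
proof -
  have "(\<lambda>N. 1 + 1 / real N) \<longlonglongrightarrow> 1 + 0"
    by (intro tendsto_add tendsto_const lim_1_over_n)
  then have "(\<lambda>N. 1 + 1 / real N) \<longlonglongrightarrow> 1" by simp
  moreover have "eventually (\<lambda>N. 1 + 1 / real N = real (Suc N) / real N) sequentially"
    using eventually_gt_at_top[of 0] by eventually_elim (simp add: field_simps)
  ultimately show ?thesis by (rule Lim_transform_eventually)
qed

text \<open>The two accumulated sums differ by \<open>T^N\<close> applied to the first term, which
  is bounded, and the denominators \<open>N\<close> and \<open>N + 1\<close> are asymptotically
  equal. The implication from the shifted sequence to \<open>x\<close> makes the shift injective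
  modulo null sequences.\<close>

lemma null_shift_iff: "null (\<lambda>k. x (Suc k)) \<longleftrightarrow> null x"
proof -
  define a where "a N = norm (acc (\<lambda>k. modulus (x k)) N)" for N
  define b where "b N = norm (acc (\<lambda>k. modulus (x (Suc k))) N)" for N
  define c where "c = M * norm (x 0)"
  have c: "norm ((T ^^ N) (modulus (x 0))) \<le> c" for N
    using power_bound[of N "modulus (x 0)"] by (simp add: c_def)
  have ab: "b N \<le> a (Suc N)" "a (Suc N) \<le> b N + c" for N
  proof -
    note shift = acc_shift[of "\<lambda>k. modulus (x k)" N]
    show "b N \<le> a (Suc N)"
      unfolding a_def b_def shift by (intro norm_mono_nonneg acc_nonneg) (simp_all add: pos_power)
    show "a (Suc N) \<le> b N + c"
      unfolding a_def b_def shift by (intro order_trans[OF norm_triangle_ineq] add_left_mono c)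
  qed
  have [simp]: "0 \<le> a N" "0 \<le> b N" for N by (simp_all add: a_def b_def)
  show ?thesis
  proof
    assume "null (\<lambda>k. x (Suc k))"
    then have "(\<lambda>N. b N / real N) \<longlonglongrightarrow> 0" by (simp add: null_def b_def)
    moreover have "(\<lambda>N. c / real N) \<longlonglongrightarrow> 0" by (rule lim_const_over_n)
    ultimately have *: "(\<lambda>N. b N / real N + c / real N) \<longlonglongrightarrow> 0"
      using tendsto_add by fastforce
    have "(\<lambda>N. a (Suc N) / real (Suc N)) \<longlonglongrightarrow> 0"
    proof (rule Lim_null_comparison[OF _ *])
      show "eventually (\<lambda>N. norm (a (Suc N) / real (Suc N)) \<le> b N / real N + c / real N) sequentially"
        using eventually_gt_at_top[of 0]
      proof eventually_elim
        case (elim N)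
        have "a (Suc N) / real (Suc N) \<le> a (Suc N) / real N"
          using elim by (intro divide_left_mono) auto
        also have "\<dots> \<le> (b N + c) / real N" using ab by (intro divide_right_mono) auto
        finally show ?case by (simp add: add_divide_distrib)
      qed
    qed
    then show "null x"
      unfolding null_def a_def[symmetric] by (rule LIMSEQ_imp_Suc)
  next
    assume "null x"
    then have "(\<lambda>N. a N / real N) \<longlonglongrightarrow> 0" by (simp add: null_def a_def)
    then have "(\<lambda>N. a (Suc N) / real (Suc N)) \<longlonglongrightarrow> 0" by (rule LIMSEQ_Suc)
    from tendsto_mult[OF this real_quotient_tendsto]
    have *: "(\<lambda>N. a (Suc N) / real N) \<longlonglongrightarrow> 0" by simp
    have "(\<lambda>N. b N / real N) \<longlonglongrightarrow> 0"
      by (rule Lim_null_comparison[OF always_eventually *]) (auto intro!: divide_right_mono ab)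
    then show "null (\<lambda>k. x (Suc k))" by (simp add: null_def b_def)
  qed
qed

lemma null_shift_add_iff: "null (\<lambda>k. x (k + m)) \<longleftrightarrow> null x"
proof (induction m arbitrary: x)
  case (Suc m)
  show ?case using Suc[of "\<lambda>k. x (Suc k)"] null_shift_iff[of x] by simp
qed simp

text \<open>The error \<open>u\<close> is uniformly small but need not be null; power boundedness
  limits its average to \<open>M * e'\<close>. The one-sided order form is what estimates of
  positive parts provide.\<close>

lemma null_closed:
  assumes "\<And>e. 0 < e \<Longrightarrow> \<exists>y u. null y \<and> (\<forall>k. 0 \<le> u k \<and> norm (u k) \<le> e \<and> modulus (x k) \<le> modulus (y k) + u k)"
  shows "null x"
  unfolding null_def
proof (rule LIMSEQ_I)
  fix e :: real assume e: "0 < e"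
  define e' where "e' = e / (2 * (M + 1))"
  have e': "0 < e'" "M * e' < e / 2"
    using e M_nonneg by (simp_all add: e'_def field_simps)
  obtain y u where y: "null y" and u: "\<And>k. 0 \<le> u k" "\<And>k. norm (u k) \<le> e'"
    and le: "\<And>k. modulus (x k) \<le> modulus (y k) + u k"
    using assms[OF e'(1)] by blast
  obtain N0 where N0: "\<And>N. N \<ge> N0 \<Longrightarrow> norm (acc (\<lambda>k. modulus (y k)) N) / real N < e / 2"
    using LIMSEQ_D[OF y[unfolded null_def], of "e / 2"] e by auto
  show "\<exists>N0. \<forall>N\<ge>N0. norm (norm (acc (\<lambda>k. modulus (x k)) N) / real N - 0) < e"
  proof (intro exI allI impI)
    fix N assume N: "N \<ge> max N0 1"
    have "norm (acc (\<lambda>k. modulus (x k)) N) \<le> norm (acc (\<lambda>k. modulus (y k) + u k) N)"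
      by (intro norm_mono_nonneg acc_nonneg acc_mono le modulus_nonneg)
    also have "\<dots> \<le> norm (acc (\<lambda>k. modulus (y k)) N) + norm (acc u N)"
      unfolding acc_add by (rule norm_triangle_ineq)
    also have "norm (acc u N) \<le> real N * (M * e')"
      by (intro norm_acc_le u)
    finally have "norm (acc (\<lambda>k. modulus (x k)) N) / real N
        \<le> (norm (acc (\<lambda>k. modulus (y k)) N) + real N * (M * e')) / real N"
      by (simp add: divide_right_mono)
    also have "\<dots> = norm (acc (\<lambda>k. modulus (y k)) N) / real N + M * e'"
      using N by (simp add: add_divide_distrib)
    also have "\<dots> < e / 2 + e / 2" using N0[of N] N e' by (intro add_strict_mono) auto
    finally show "norm (norm (acc (\<lambda>k. modulus (x k)) N) / real N - 0) < e" by simp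
  qed
qed

lemma null_closed_norm:
  assumes "\<And>e. 0 < e \<Longrightarrow> \<exists>y. null y \<and> (\<forall>k. norm (x k - y k) \<le> e)"
  shows "null x"
proof (rule null_closed)
  fix e :: real assume "0 < e"
  then obtain y where y: "null y" "\<And>k. norm (x k - y k) \<le> e" using assms by blast
  have "modulus (x k) \<le> modulus (y k) + modulus (x k - y k)" for k
    using modulus_triangle[of "y k" "x k - y k"] by simp
  with y show "\<exists>y u. null y \<and> (\<forall>k. 0 \<le> u k \<and> norm (u k) \<le> e \<and> modulus (x k) \<le> modulus (y k) + u k)"
    by (intro exI[of _ y] exI[of _ "\<lambda>k. modulus (x k - y k)"]) simp
qed

section \<open>Asymptotic orbits\<close>

definition asymp_orbit :: "(nat \<Rightarrow> 'a) \<Rightarrow> bool" where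
  "asymp_orbit x \<longleftrightarrow> (\<exists>C. \<forall>k. norm (x k) \<le> C) \<and> null (\<lambda>k. x (Suc k) - T (x k))"

lemma asymp_orbitE:
  assumes "asymp_orbit x"
  obtains C where "0 \<le> C" "\<And>k. norm (x k) \<le> C" "null (\<lambda>k. x (Suc k) - T (x k))"
proof -
  obtain C where C: "\<And>k. norm (x k) \<le> C" and n: "null (\<lambda>k. x (Suc k) - T (x k))"
    using assms by (auto simp: asymp_orbit_def)
  have "0 \<le> C" using C[of 0] norm_ge_zero order_trans by blast
  then show ?thesis using C n by (rule that)
qed

lemma asymp_orbit_bounded:
  assumes "asymp_orbit x"
  obtains C where "0 \<le> C" "\<And>k. norm (x k) \<le> C"
  by (rule asymp_orbitE[OF assms], rule that)

lemma asymp_orbitI: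
  "(\<And>k. norm (x k) \<le> C) \<Longrightarrow> null (\<lambda>k. x (Suc k) - T (x k)) \<Longrightarrow> asymp_orbit x"
  by (auto simp: asymp_orbit_def)

lemma asymp_orbit_power: "asymp_orbit (\<lambda>k. (T ^^ k) f)"
  by (rule asymp_orbitI[OF power_bound]) (simp add: null_zero)

lemma asymp_orbit_add:
  assumes "asymp_orbit x" "asymp_orbit y"
  shows "asymp_orbit (\<lambda>k. x k + y k)"
proof -
  obtain C D where C: "\<And>k. norm (x k) \<le> C" "null (\<lambda>k. x (Suc k) - T (x k))"
    and D: "\<And>k. norm (y k) \<le> D" "null (\<lambda>k. y (Suc k) - T (y k))"
    using assms by (metis asymp_orbitE)
  show ?thesis
  proof (rule asymp_orbitI)
    show "norm (x k + y k) \<le> C + D" for k by (intro norm_triangle_mono C D)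
    show "null (\<lambda>k. x (Suc k) + y (Suc k) - T (x k + y k))"
      using null_add[OF C(2) D(2)] by (simp add: T_add add_diff_add)
  qed
qed

lemma asymp_orbit_scaleR:
  assumes "asymp_orbit x"
  shows "asymp_orbit (\<lambda>k. r *\<^sub>R x k)"
proof -
  obtain C where C: "\<And>k. norm (x k) \<le> C" "null (\<lambda>k. x (Suc k) - T (x k))"
    using assms by (metis asymp_orbitE)
  show ?thesis
  proof (rule asymp_orbitI)
    show "norm (r *\<^sub>R x k) \<le> \<bar>r\<bar> * C" for k by (simp add: mult_left_mono C)
    show "null (\<lambda>k. r *\<^sub>R x (Suc k) - T (r *\<^sub>R x k))"
      using null_scaleR[OF C(2), of r] by (simp add: T_scaleR scaleR_diff_right)
  qed
qed

lemma asymp_orbit_diff: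
  "asymp_orbit x \<Longrightarrow> asymp_orbit y \<Longrightarrow> asymp_orbit (\<lambda>k. x k - y k)"
  using asymp_orbit_add[of x "\<lambda>k. (-1) *\<^sub>R y k"] asymp_orbit_scaleR[of y "-1"] by simp

lemma asymp_orbit_shift: "asymp_orbit x \<Longrightarrow> asymp_orbit (\<lambda>k. x (Suc k))"
  using null_shift_iff[of "\<lambda>k. x (Suc k) - T (x k)"] by (auto simp: asymp_orbit_def)

text \<open>Up to a null sequence, \<open>T \<bar>x k\<bar> - \<bar>x (Suc k)\<bar>\<close> is nonnegative, and its
  accumulated sum telescopes; hence it is null.\<close>

lemma asymp_orbit_modulus:
  assumes "asymp_orbit x"
  shows "asymp_orbit (\<lambda>k. modulus (x k))"
proof -
  obtain C where C: "0 \<le> C" "\<And>k. norm (x k) \<le> C" "null (\<lambda>k. x (Suc k) - T (x k))"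
    using asymp_orbitE[OF assms] by blast
  define y where "y k = modulus (x k)" for k
  define n where "n k = modulus (x (Suc k) - T (x k))" for k
  \<comment> \<open>Adding \<open>n\<close> makes the defect nonnegative, hence equal to its own
    modulus, so the telescoped sum controls it directly.\<close>
  define d where "d k = (T (y k) - y (Suc k)) + n k" for k
  have n: "null n" using C(3) by (simp add: null_def n_def)
  have d0: "0 \<le> d k" for k
  proof -
    have "y (Suc k) \<le> modulus (T (x k)) + n k"
      using modulus_triangle[of "T (x k)" "x (Suc k) - T (x k)"] by (simp add: y_def n_def)
    also have "\<dots> \<le> T (y k) + n k"
      unfolding y_def by (intro add_right_mono modulus_T)
    finally have "0 \<le> T (y k) + n k - y (Suc k)" by simp
    then show ?thesis by (simp only: d_def diff_add_eq)
  qed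
  have "null d"
  proof (rule nullI)
    have "(\<lambda>N. (M * C + C) / real N + norm (acc (\<lambda>k. modulus (n k)) N) / real N) \<longlonglongrightarrow> 0"
      using tendsto_add[OF lim_const_over_n n[unfolded null_def]] by simp
    then show "(\<lambda>N. norm (acc d N) / real N) \<longlonglongrightarrow> 0"
    proof (rule Lim_null_comparison[rotated], intro always_eventually allI)
      fix N
      have "acc d N = (T ^^ N) (y 0) - y N + acc n N"
        unfolding d_def acc_add acc_telescope ..
      also have "norm \<dots> \<le> (M * C + C) + norm (acc n N)"
      proof (intro order_trans[OF norm_triangle_ineq] add_right_mono order_trans[OF norm_triangle_ineq4] add_mono)
        show "norm ((T ^^ N) (y 0)) \<le> M * C"
          using power_bound[of N "y 0"] mult_left_mono[OF C(2)[of 0] M_nonneg] by (simp add: y_def)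
        show "norm (y N) \<le> C" using C(2) by (simp add: y_def)
      qed
      also have "acc n N = acc (\<lambda>k. modulus (n k)) N" by (simp add: n_def[abs_def])
      finally show "norm (norm (acc d N) / real N)
          \<le> (M * C + C) / real N + norm (acc (\<lambda>k. modulus (n k)) N) / real N"
        by (simp add: divide_right_mono flip: add_divide_distrib)
    qed
    show "modulus (d k) \<le> d k" for k using d0 by simp
  qed
  then have "null (\<lambda>k. n k - d k)" by (intro null_diff n)
  moreover have "n k - d k = y (Suc k) - T (y k)" for k by (simp add: d_def)
  ultimately show ?thesis
    using C by (intro asymp_orbitI[of _ C]) (simp_all add: y_def)
qed

lemma asymp_orbit_pprt:
  "asymp_orbit x \<Longrightarrow> asymp_orbit (\<lambda>k. pprt (x k))"
  unfolding pprt_eq_half by (intro asymp_orbit_scaleR asymp_orbit_add asymp_orbit_modulus)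

lemma asymp_orbit_inf:
  assumes "asymp_orbit x" "asymp_orbit y"
  shows "asymp_orbit (\<lambda>k. inf (x k) (y k))"
proof -
  have "x k - pprt (x k - y k) = inf (x k) (y k)" for k
    unfolding diff_inf_eq_pprt[symmetric] by (simp only: diff_diff_eq2 add_diff_cancel_left')
  then show ?thesis
    using asymp_orbit_diff[OF assms(1) asymp_orbit_pprt[OF asymp_orbit_diff[OF assms]]] by simp
qed

lemma asymp_orbit_power_null:
  assumes "asymp_orbit x"
  shows "null (\<lambda>k. x (k + m) - (T ^^ m) (x k))"
proof (induction m)
  case (Suc m)
  have "null (\<lambda>k. x (Suc k) - T (x k))" using assms by (simp add: asymp_orbit_def)
  then have "null (\<lambda>k. x (Suc (k + m)) - T (x (k + m)))"
    using null_shift_add_iff[of "\<lambda>k. x (Suc k) - T (x k)" m] by simp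
  from null_add[OF this null_T[OF Suc]] show ?case by (simp add: T_diff)
qed (simp add: null_zero)

text \<open>Partial sums are finite combinations of shifts of \<open>r\<close>, hence null; the
  tails are uniformly small because \<open>r\<close> is bounded.\<close>

lemma null_geometric:
  assumes q: "0 \<le> q" "q < 1" and r: "null r" "\<And>k. norm (r k) \<le> D"
  shows "null (\<lambda>k. \<Sum>j. q ^ j *\<^sub>R r (k + j))"
proof (rule null_closed_norm)
  fix e :: real assume e: "0 < e"
  have "(\<lambda>J. q ^ J * (D / (1 - q))) \<longlonglongrightarrow> 0"
    using q by (intro tendsto_mult_left_zero LIMSEQ_power_zero) simp
  then have "eventually (\<lambda>J. q ^ J * (D / (1 - q)) < e) sequentially"
    using e by (rule order_tendstoD(2))
  then obtain J where J: "q ^ J * (D / (1 - q)) < e"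
    by (auto simp: eventually_sequentially)
  have sg: "summable (\<lambda>j. q ^ j * D)" using q by (intro summable_mult2 summable_geometric) simp
  have bound: "norm (q ^ j *\<^sub>R r i) \<le> q ^ j * D" for i j
    using q r(2)[of i] by (simp add: mult_left_mono)
  have summ: "summable (\<lambda>j. q ^ j *\<^sub>R r (k + j))" for k
    by (rule summable_comparison_test'[OF sg]) (rule bound)
  have "norm ((\<Sum>j. q ^ j *\<^sub>R r (k + j)) - (\<Sum>j<J. q ^ j *\<^sub>R r (k + j))) \<le> e" for k
  proof -
    have "(\<Sum>j. q ^ j *\<^sub>R r (k + j)) - (\<Sum>j<J. q ^ j *\<^sub>R r (k + j)) = (\<Sum>j. q ^ (j + J) *\<^sub>R r (k + (j + J)))"
      using suminf_minus_initial_segment[OF summ[of k], of J] by simp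
    also have "norm \<dots> \<le> (\<Sum>j. q ^ (j + J) * D)"
      by (intro norm_suminf_le bound summable_ignore_initial_segment sg)
    also have "\<dots> = (\<Sum>j. q ^ j * (q ^ J * D))" by (simp add: power_add mult.assoc)
    also have "\<dots> = (\<Sum>j. q ^ j) * (q ^ J * D)"
      using q by (intro suminf_mult2[symmetric] summable_geometric) simp
    also have "\<dots> = q ^ J * (D / (1 - q))" using q by (simp add: suminf_geometric)
    finally show ?thesis using J by simp
  qed
  moreover have "null (\<lambda>k. \<Sum>j<J. q ^ j *\<^sub>R r (k + j))"
    using r(1) by (intro null_sum null_scaleR) (simp add: null_shift_add_iff)
  ultimately show "\<exists>y. null y \<and> (\<forall>k. norm ((\<Sum>j. q ^ j *\<^sub>R r (k + j)) - y k) \<le> e)"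
    by blast
qed

text \<open>The resolvent \<open>w\<close> of the shift is a supersolution of \<open>w (Suc k) \<le> l *\<^sub>R w k\<close>
  dominating \<open>f\<close>; it plays the role of an almost invariant order unit.\<close>

lemma asymp_orbit_resolvent:
  assumes f: "asymp_orbit f" "\<And>k. 0 \<le> f k" and l: "1 < l"
  obtains w D where "asymp_orbit w" "\<And>k. 0 \<le> w k" "\<And>k. f k \<le> w k" "\<And>k. w (Suc k) \<le> l *\<^sub>R w k"
    "\<And>k. norm (w k) \<le> D" "0 \<le> D"
proof -
  obtain C where C: "0 \<le> C" "\<And>k. norm (f k) \<le> C" "null (\<lambda>k. f (Suc k) - T (f k))"
    using asymp_orbitE[OF f(1)] by blast
  define q where "q = inverse l"
  have q: "0 < q" "q < 1" using l by (simp_all add: q_def field_simps)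
  have lq: "l * q = 1" using l by (simp add: q_def)
  have sg: "summable (\<lambda>j. q ^ j * C)" using q by (intro summable_mult2 summable_geometric) simp
  have bound: "norm (q ^ j *\<^sub>R f i) \<le> q ^ j * C" for i j
    using q C(2)[of i] by (simp add: mult_left_mono)
  have summ: "summable (\<lambda>j. q ^ j *\<^sub>R f (k + j))" for k
    by (rule summable_comparison_test'[OF sg]) (rule bound)
  define w where "w k = (\<Sum>j. q ^ j *\<^sub>R f (k + j))" for k
  define D where "D = (\<Sum>j. q ^ j * C)"
  have wD: "norm (w k) \<le> D" for k
    unfolding w_def D_def by (rule norm_suminf_le[OF bound sg])
  have D: "0 \<le> D" using wD[of 0] norm_ge_zero order_trans by blast
  have w0: "0 \<le> w k" for k
    unfolding w_def using f(2) q by (intro suminf_nonneg_lattice summ scaleR_nonneg_nonneg) auto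
  \<comment> \<open>Both order relations come from this recursion: dropping the tail gives
    \<open>f k \<le> w k\<close>, while multiplying by \<open>l = 1 / q\<close> and dropping
    \<open>f k\<close> gives \<open>w (Suc k) \<le> l *\<^sub>R w k\<close>.\<close>
  have rec: "w k = f k + q *\<^sub>R w (Suc k)" for k
  proof -
    have "w k = f k + (\<Sum>j. q ^ Suc j *\<^sub>R f (k + Suc j))"
      using suminf_split_head[OF summ[of k]] by (simp add: w_def)
    also have "(\<Sum>j. q ^ Suc j *\<^sub>R f (k + Suc j)) = (\<Sum>j. q *\<^sub>R (q ^ j *\<^sub>R f (Suc k + j)))"
      by simp
    also have "\<dots> = q *\<^sub>R w (Suc k)"
      unfolding w_def using bounded_linear.suminf[OF bounded_linear_scaleR_right summ[of "Suc k"], of q] by simp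
    finally show ?thesis .
  qed
  have fw: "f k \<le> w k" for k
    using rec[of k] scaleR_nonneg_nonneg[OF less_imp_le[OF q(1)] w0[of "Suc k"]] by simp
  have lw: "w (Suc k) \<le> l *\<^sub>R w k" for k
  proof -
    have "l *\<^sub>R w k = l *\<^sub>R f k + (l * q) *\<^sub>R w (Suc k)"
      by (subst rec) (simp add: scaleR_add_right)
    then show ?thesis using lq l scaleR_nonneg_nonneg[of l "f k"] f(2)[of k] by simp
  qed
  have "null (\<lambda>k. w (Suc k) - T (w k))"
  proof -
    define r where "r k = f (Suc k) - T (f k)" for k
    have rb: "norm (r k) \<le> C + M * C" for k
      unfolding r_def
    proof (intro order_trans[OF norm_triangle_ineq4] add_mono C)
      show "norm (T (f k)) \<le> M * C"
        using norm_T[of "f k"] mult_left_mono[OF C(2)[of k] M_nonneg] by linarith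
    qed
    have "null (\<lambda>k. \<Sum>j. q ^ j *\<^sub>R r (k + j))"
      using q C(3) rb by (intro null_geometric[where D = "C + M * C"]) (simp_all add: r_def)
    moreover have "(\<Sum>j. q ^ j *\<^sub>R r (k + j)) = w (Suc k) - T (w k)" for k
    proof -
      have "T (w k) = (\<Sum>j. T (q ^ j *\<^sub>R f (k + j)))"
        unfolding w_def by (rule bounded_linear.suminf[OF bounded_linear_T summ])
      moreover have "summable (\<lambda>j. T (q ^ j *\<^sub>R f (k + j)))"
        by (rule bounded_linear.summable[OF bounded_linear_T summ])
      ultimately have "w (Suc k) - T (w k) = (\<Sum>j. q ^ j *\<^sub>R f (Suc k + j) - T (q ^ j *\<^sub>R f (k + j)))"
        unfolding w_def using suminf_diff[OF summ[of "Suc k"]] by simp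
      then show ?thesis by (simp add: r_def T_scaleR scaleR_diff_right)
    qed
    ultimately show ?thesis by simp
  qed
  then have "asymp_orbit w" using wD by (intro asymp_orbitI)
  then show ?thesis using w0 fw lw wD D by (rule that)
qed

section \<open>Consequences of a gap between consecutive powers\<close>

context
  fixes m :: nat and e :: real
  assumes e: "0 \<le> e" "e < 1"
    and gap: "\<And>f. norm ((T ^^ Suc m) f - (T ^^ m) f) \<le> e * norm f"
begin

text \<open>Modulo null sequences the shift acts on asymptotic orbits as \<open>T\<close> and is isometric, so \<open>v\<close> and
  its shift have distance at most \<open>e\<close> times the size of \<open>v\<close>; disjointness makes that
  distance at least the size of \<open>v\<close>.\<close>

lemma null_of_disjoint_shift:
  assumes v: "asymp_orbit v" "\<And>k. 0 \<le> v k" and disj: "\<And>k. inf (v k) (v (Suc k)) = 0"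
  shows "null v"
proof -
  obtain C where C: "0 \<le> C" "\<And>k. norm (v k) \<le> C"
    by (rule asymp_orbit_bounded[OF v(1)], rule that)
  \<comment> \<open>One pass improves the uniform distance of \<open>v\<close> from the null
    sequences by the factor \<open>e\<close>; iteration drives it to 0.\<close>
  have step: "\<exists>n. null n \<and> (\<forall>k. norm (v k - n k) \<le> e * c)"
    if n: "null n" "\<And>k. norm (v k - n k) \<le> c" for n c
  proof -
    have c0: "0 \<le> c" using n(2)[of 0] norm_ge_zero order_trans by blast
    define y where "y k = v (Suc k) - v k" for k
    \<comment> \<open>Modulo the null sequence \<open>r\<close>, \<open>y (k + m)\<close> is
      \<open>T^(m+1) - T^m\<close> applied to \<open>v k\<close>. Split \<open>v\<close> as
      \<open>n + (v - n)\<close>: the part \<open>d\<close> coming from \<open>n\<close> is null,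
      and the gap applies to the rest.\<close>
    define d where "d k = (T ^^ Suc m) (n k) - (T ^^ m) (n k)" for k
    define r where "r k = (v (k + Suc m) - (T ^^ Suc m) (v k)) - (v (k + m) - (T ^^ m) (v k))" for k
    define n1 where "n1 k = d k + r k" for k
    have n1: "null n1"
      unfolding n1_def d_def r_def
      by (rule null_add[OF null_diff[OF null_power[OF n(1)] null_power[OF n(1)]]
            null_diff[OF asymp_orbit_power_null[OF v(1)] asymp_orbit_power_null[OF v(1)]]])
    have yn1: "norm (y (k + m) - n1 k) \<le> e * c" for k
    proof -
      have "y (k + m) - n1 k = ((T ^^ Suc m) (v k) - (T ^^ Suc m) (n k)) - ((T ^^ m) (v k) - (T ^^ m) (n k))"
        by (simp add: y_def n1_def d_def r_def del: funpow.simps)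
      also have "\<dots> = (T ^^ Suc m) (v k - n k) - (T ^^ m) (v k - n k)"
        by (simp only: linear_simps(2)[OF bounded_linear_power])
      also have "norm \<dots> \<le> e * norm (v k - n k)" by (rule gap)
      also have "\<dots> \<le> e * c" by (intro mult_left_mono n e)
      finally show ?thesis .
    qed
    \<comment> \<open>Undoes the shift by \<open>m\<close>. The first \<open>m\<close> entries are
      copied from \<open>y\<close>, so they carry no error, and they do not influence
      nullity.\<close>
    define n2 where "n2 k = (if k < m then y k else n1 (k - m))" for k
    have "null (\<lambda>k. n2 (k + m))" using n1 by (simp add: n2_def)
    then have n2: "null n2" by (simp only: null_shift_add_iff)
    have yn2: "norm (y k - n2 k) \<le> e * c" for k
      using yn1[of "k - m"] e c0 by (cases "k < m") (simp_all add: n2_def)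
    \<comment> \<open>By disjointness \<open>v k \<le> modulus (y k)\<close>, so the excess of
      \<open>v k\<close> over \<open>modulus (y k - n2 k)\<close> is dominated by
      \<open>modulus (n2 k)\<close>. What remains of \<open>v k\<close> is a meet of norm at most
      \<open>e * c\<close>.\<close>
    define n3 where "n3 k = pprt (v k - modulus (y k - n2 k))" for k
    have "null n3"
    proof (rule null_mono[OF n2])
      fix k
      have "v k \<le> v (Suc k) + v k" using v(2) by (simp add: add_increasing)
      also have "\<dots> = modulus (y k)"
        unfolding y_def using disj[of k] by (intro modulus_diff_disjoint[symmetric]) (simp add: inf_commute)
      also have "\<dots> \<le> modulus (n2 k) + modulus (y k - n2 k)"
        using modulus_triangle[of "n2 k" "y k - n2 k"] by simp
      finally have "n3 k \<le> modulus (n2 k)"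
        unfolding n3_def by (intro pprt_least) (simp_all only: diff_le_eq modulus_nonneg)
      then show "modulus (n3 k) \<le> modulus (n2 k)" by (simp add: n3_def)
    qed
    moreover have "norm (v k - n3 k) \<le> e * c" for k
    proof -
      have "v k - n3 k = inf (v k) (modulus (y k - n2 k))"
        unfolding n3_def diff_inf_eq_pprt[symmetric] by (simp only: diff_diff_eq2 add_diff_cancel_left')
      also have "norm \<dots> \<le> norm (modulus (y k - n2 k))"
        by (intro norm_mono_nonneg le_infI v) simp_all
      finally show ?thesis using yn2[of k] by simp
    qed
    ultimately show ?thesis by blast
  qed
  have near: "\<exists>n. null n \<and> (\<forall>k. norm (v k - n k) \<le> e ^ i * C)" for i
  proof (induction i)
    case 0
    show ?case using null_zero C by (intro exI[of _ "\<lambda>k. 0"]) simp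
  next
    case (Suc i)
    then obtain n where "null n" "\<And>k. norm (v k - n k) \<le> e ^ i * C" by blast
    from step[OF this] show ?case by (simp add: mult.assoc)
  qed
  show ?thesis
  proof (rule null_closed_norm)
    fix b :: real assume b: "0 < b"
    have "(\<lambda>i. e ^ i * C) \<longlonglongrightarrow> 0"
      using e by (intro tendsto_mult_left_zero LIMSEQ_power_zero) simp
    then have "eventually (\<lambda>i. e ^ i * C < b) sequentially"
      using b by (rule order_tendstoD(2))
    then obtain i where i: "e ^ i * C < b" by (auto simp: eventually_sequentially)
    obtain n where n: "null n" "\<And>k. norm (v k - n k) \<le> e ^ i * C" using near by blast
    have "norm (v k - n k) \<le> b" for k using n(2)[of k] i by linarith
    with n(1) show "\<exists>y. null y \<and> (\<forall>k. norm (v k - y k) \<le> b)" by blast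
  qed
qed

text \<open>With \<open>a i = \<alpha> * l ^ i\<close>, the part of \<open>f (Suc k)\<close> above \<open>a (Suc i) *\<^sub>R w k\<close> where
  \<open>f k\<close> is below \<open>a i *\<^sub>R w k\<close> is disjoint from its shift.  Descending through the levels
  \<open>a i\<close> gives \<open>f (Suc k) \<le> l\<^sup>2 *\<^sub>R f k + a 1 *\<^sub>R w k\<close> up to a null sequence.\<close>

lemma null_pprt_increment_approx:
  assumes f: "asymp_orbit f" "\<And>k. 0 \<le> f k"
    and w: "asymp_orbit w" "\<And>k. 0 \<le> w k" "\<And>k. f k \<le> w k" "\<And>k. w (Suc k) \<le> l *\<^sub>R w k"
    and l: "1 < l" and al: "0 < \<alpha>"
  shows "null (\<lambda>k. pprt (f (Suc k) - l\<^sup>2 *\<^sub>R f k - (\<alpha> * l) *\<^sub>R w k))"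
proof -
  define a where "a i = \<alpha> * l ^ i" for i
  have a0: "0 \<le> a i" for i using al l by (simp add: a_def)
  have aS: "a (Suc i) = l * a i" for i by (simp add: a_def)
  define lo where "lo i k = pprt (a i *\<^sub>R w k - f k)" for i k
  define hi where "hi i k = pprt (f (Suc k) - a i *\<^sub>R w k)" for i k
  define z where "z k = pprt (f (Suc k) - l\<^sup>2 *\<^sub>R f k - a 1 *\<^sub>R w k)" for k
  have lo0: "0 \<le> lo i k" and hi0: "0 \<le> hi i k" and z0: "0 \<le> z k" for i k
    by (simp_all add: lo_def hi_def z_def)
  have v: "null (\<lambda>k. inf (lo i k) (hi (Suc i) k))" for i
  proof (rule null_of_disjoint_shift)
    show "asymp_orbit (\<lambda>k. inf (lo i k) (hi (Suc i) k))"
      unfolding lo_def hi_def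
      by (intro asymp_orbit_inf asymp_orbit_pprt asymp_orbit_diff asymp_orbit_scaleR asymp_orbit_shift f w)
    show "0 \<le> inf (lo i k) (hi (Suc i) k)" for k using lo0 hi0 by simp
    show "inf (inf (lo i k) (hi (Suc i) k)) (inf (lo i (Suc k)) (hi (Suc i) (Suc k))) = 0" for k
    proof (rule antisym)
      \<comment> \<open>\<open>hi (Suc i) k\<close> measures \<open>f (Suc k)\<close> above the
        level \<open>a (Suc i) *\<^sub>R w k\<close>. \<open>lo i (Suc k)\<close> measures the same
        \<open>f (Suc k)\<close> below \<open>a i *\<^sub>R w (Suc k)\<close>, which the growth
        bound on \<open>w\<close> places under that very level.\<close>
      have "a i *\<^sub>R w (Suc k) \<le> a i *\<^sub>R (l *\<^sub>R w k)"
        by (intro scaleR_left_mono w a0)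
      then have "a i *\<^sub>R w (Suc k) - f (Suc k) \<le> - (f (Suc k) - a (Suc i) *\<^sub>R w k)"
        by (simp add: aS mult.commute)
      then have "lo i (Suc k) \<le> pprt (- (f (Suc k) - a (Suc i) *\<^sub>R w k))"
        unfolding lo_def by (rule pprt_mono)
      then have "inf (hi (Suc i) k) (lo i (Suc k)) \<le> inf (hi (Suc i) k) (pprt (- (f (Suc k) - a (Suc i) *\<^sub>R w k)))"
        by (intro inf_mono) simp_all
      also have "\<dots> = 0" unfolding hi_def by (rule pprt_disjoint)
      finally have "inf (hi (Suc i) k) (lo i (Suc k)) \<le> 0" .
      moreover have "inf (inf (lo i k) (hi (Suc i) k)) (inf (lo i (Suc k)) (hi (Suc i) (Suc k)))
          \<le> inf (hi (Suc i) k) (lo i (Suc k))"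
        by (intro inf_mono) simp_all
      ultimately show "inf (inf (lo i k) (hi (Suc i) k)) (inf (lo i (Suc k)) (hi (Suc i) (Suc k))) \<le> 0"
        by (rule order_trans[rotated])
      show "0 \<le> inf (inf (lo i k) (hi (Suc i) k)) (inf (lo i (Suc k)) (hi (Suc i) (Suc k)))"
        using lo0 hi0 by simp
    qed
  qed
  \<comment> \<open>The descent starts where nothing is left: once \<open>l \<le> a (Suc n)\<close>,
    the bound \<open>f (Suc k) \<le> w (Suc k) \<le> l *\<^sub>R w k\<close> makes
    \<open>hi (Suc n)\<close> vanish.\<close>
  obtain n where n: "l / \<alpha> < l ^ n" using real_arch_pow[OF l] by blast
  have "l \<le> a (Suc n)"
  proof -
    have "l < a n" using n al by (simp add: a_def field_simps)
    also have "a n \<le> a (Suc n)" using a0[of n] l by (simp add: aS mult_le_cancel_right1)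
    finally show ?thesis by simp
  qed
  have top: "hi (Suc n) k = 0" for k
  proof -
    have "f (Suc k) \<le> w (Suc k)" by (rule w)
    also have "\<dots> \<le> l *\<^sub>R w k" by (rule w)
    also have "\<dots> \<le> a (Suc n) *\<^sub>R w k" using \<open>l \<le> a (Suc n)\<close> w(2) by (intro scaleR_right_mono)
    finally show ?thesis unfolding hi_def by (intro pprt_eq_0) simp
  qed
  have desc: "null (\<lambda>k. inf (z k) (hi (Suc i) k))" if "null (\<lambda>k. inf (z k) (hi (Suc (Suc i)) k))" for i
  proof (rule null_mono'[OF null_add[OF that null_scaleR[OF v[of i], of "l\<^sup>2"]]])
    fix k
    define t where "t = inf (z k) (hi (Suc i) k)"
    have t0: "0 \<le> t" using z0 hi0 by (simp add: t_def)
    \<comment> \<open>Origin of the factor \<open>l\<^sup>2\<close>: since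
      \<open>a (Suc (Suc i)) = l\<^sup>2 * a i\<close>, the multiples of \<open>w k\<close> cancel
      on the right, and \<open>z\<close> is split into an excess two levels up and a deficit at
      level \<open>i\<close>.\<close>
    have "f (Suc k) - l\<^sup>2 *\<^sub>R f k - a 1 *\<^sub>R w k
        \<le> (f (Suc k) - a (Suc (Suc i)) *\<^sub>R w k) + l\<^sup>2 *\<^sub>R (a i *\<^sub>R w k - f k)"
      using scaleR_nonneg_nonneg[OF a0[of 1] w(2)[of k]]
      by (simp add: aS scaleR_diff_right power2_eq_square mult.assoc)
    then have "z k \<le> pprt ((f (Suc k) - a (Suc (Suc i)) *\<^sub>R w k) + l\<^sup>2 *\<^sub>R (a i *\<^sub>R w k - f k))"
      unfolding z_def by (rule pprt_mono)
    also have "\<dots> \<le> hi (Suc (Suc i)) k + l\<^sup>2 *\<^sub>R lo i k"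
      unfolding hi_def lo_def
      using pprt_add[of "f (Suc k) - a (Suc (Suc i)) *\<^sub>R w k" "l\<^sup>2 *\<^sub>R (a i *\<^sub>R w k - f k)"]
        pprt_scaleR[of "l\<^sup>2" "a i *\<^sub>R w k - f k"] by simp
    finally have "t \<le> hi (Suc (Suc i)) k + l\<^sup>2 *\<^sub>R lo i k"
      unfolding t_def by (rule le_infI1)
    then have "t \<le> inf t (hi (Suc (Suc i)) k + l\<^sup>2 *\<^sub>R lo i k)" by simp
    also have "\<dots> \<le> inf t (hi (Suc (Suc i)) k) + inf t (l\<^sup>2 *\<^sub>R lo i k)"
      by (intro inf_add_le scaleR_nonneg_nonneg lo0 hi0 t0) simp
    also have "\<dots> \<le> inf (z k) (hi (Suc (Suc i)) k) + l\<^sup>2 *\<^sub>R inf t (lo i k)"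
      using lo0 hi0 t0 l by (intro add_mono inf_mono inf_scaleR_le) (simp_all add: t_def one_le_power)
    also have "\<dots> \<le> inf (z k) (hi (Suc (Suc i)) k) + l\<^sup>2 *\<^sub>R inf (lo i k) (hi (Suc i) k)"
      unfolding inf_commute[of t] by (intro add_left_mono scaleR_left_mono inf_mono) (simp_all add: t_def)
    finally show "inf (z k) (hi (Suc i) k)
        \<le> inf (z k) (hi (Suc (Suc i)) k) + l\<^sup>2 *\<^sub>R inf (lo i k) (hi (Suc i) k)"
      unfolding t_def .
    show "0 \<le> inf (z k) (hi (Suc i) k)" using t0 by (simp only: t_def)
  qed
  have "null (\<lambda>k. inf (z k) (hi (Suc i) k))" if "i \<le> n" for i
    using that
  proof (induction i rule: inc_induct)
    case base
    show ?case using top z0 null_zero by (simp add: inf_absorb2)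
  next
    case (step i)
    show ?case by (rule desc[OF step.IH])
  qed
  from this[of 0] have "null (\<lambda>k. inf (z k) (hi (Suc 0) k))" by simp
  \<comment> \<open>At the bottom the meet is redundant, because \<open>z\<close> subtracts at least
    the level \<open>a 1 *\<^sub>R w k\<close> used in \<open>hi (Suc 0)\<close>.\<close>
  moreover have "inf (z k) (hi (Suc 0) k) = z k" for k
  proof (rule inf_absorb1)
    show "z k \<le> hi (Suc 0) k"
      unfolding z_def hi_def One_nat_def
      using scaleR_nonneg_nonneg[OF zero_le_power2 f(2)[of k], of l] by (intro pprt_mono diff_right_mono) simp
  qed
  ultimately show ?thesis by (simp add: z_def[abs_def] a_def)
qed

text \<open>In the approximate bound let \<open>l\<close> tend to 1 and \<open>\<alpha>\<close> to
  0; the correction \<open>u\<close> becomes uniformly small. The factor \<open>l\<close> is fixed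
  first, since \<open>w\<close> and its bound \<open>D\<close> depend on it.\<close>

lemma null_pprt_increment:
  assumes f: "asymp_orbit f" "\<And>k. 0 \<le> f k"
  shows "null (\<lambda>k. pprt (f (Suc k) - f k))"
proof (rule null_closed)
  fix b :: real assume b: "0 < b"
  obtain C where C: "0 \<le> C" "\<And>k. norm (f k) \<le> C"
    by (rule asymp_orbit_bounded[OF f(1)], rule that)
  obtain l where l: "1 < l" "(l\<^sup>2 - 1) * C \<le> b / 2"
  proof -
    have "((\<lambda>l::real. (l\<^sup>2 - 1) * C) \<longlongrightarrow> (1\<^sup>2 - 1) * C) (at_right 1)"
      by (intro tendsto_intros)
    then have "eventually (\<lambda>l::real. (l\<^sup>2 - 1) * C < b / 2) (at_right 1)"
      using b by (intro order_tendstoD(2)[of _ "(1\<^sup>2 - 1) * C"]) simp_all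
    moreover have "eventually (\<lambda>l::real. 1 < l) (at_right 1)"
      by (rule eventually_at_right_less)
    ultimately have "eventually (\<lambda>l::real. 1 < l \<and> (l\<^sup>2 - 1) * C < b / 2) (at_right 1)"
      by eventually_elim simp
    then obtain l :: real where "1 < l \<and> (l\<^sup>2 - 1) * C < b / 2"
      using eventually_happens'[OF trivial_limit_at_right_real] by blast
    then show ?thesis using that[of l] by simp
  qed
  obtain w D where w: "asymp_orbit w" "\<And>k. 0 \<le> w k" "\<And>k. f k \<le> w k" "\<And>k. w (Suc k) \<le> l *\<^sub>R w k"
    and D: "\<And>k. norm (w k) \<le> D" "0 \<le> D"
    using asymp_orbit_resolvent[OF f l(1)] by metis
  \<comment> \<open>Dividing by \<open>l\<close> cancels the factor in
    \<open>\<alpha> * l * D\<close>, and \<open>D + 1\<close> guards against \<open>D = 0\<close>;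
    the \<open>w\<close> term then costs at most \<open>b / 2\<close>.\<close>
  define \<alpha> where "\<alpha> = b / (2 * (D + 1)) / l"
  have al: "0 < \<alpha>" and alD: "\<alpha> * l * D \<le> b / 2"
  proof -
    show "0 < \<alpha>" using b l D by (simp add: \<alpha>_def)
    have "\<alpha> * l * D = (b / 2) * (D / (D + 1))"
      using l(1) by (simp add: \<alpha>_def)
    also have "\<dots> \<le> (b / 2) * 1" using b D by (intro mult_left_mono) (simp_all add: field_simps)
    finally show "\<alpha> * l * D \<le> b / 2" by simp
  qed
  define y where "y k = pprt (f (Suc k) - l\<^sup>2 *\<^sub>R f k - (\<alpha> * l) *\<^sub>R w k)" for k
  define u where "u k = (l\<^sup>2 - 1) *\<^sub>R f k + (\<alpha> * l) *\<^sub>R w k" for k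
  have l2: "0 \<le> l\<^sup>2 - 1" using l by (simp add: one_le_power)
  have u0: "0 \<le> u k" for k
    unfolding u_def using l2 l al f w by (intro add_nonneg_nonneg scaleR_nonneg_nonneg) auto
  have "null y"
    unfolding y_def by (rule null_pprt_increment_approx[OF f w l(1) al])
  moreover have "norm (u k) \<le> b" for k
  proof -
    have "norm (u k) \<le> (l\<^sup>2 - 1) * norm (f k) + (\<alpha> * l) * norm (w k)"
      unfolding u_def using norm_triangle_ineq[of "(l\<^sup>2 - 1) *\<^sub>R f k" "(\<alpha> * l) *\<^sub>R w k"] l2 l al by simp
    also have "\<dots> \<le> (l\<^sup>2 - 1) * C + (\<alpha> * l) * D"
      using l2 l al by (intro add_mono mult_left_mono C D) auto
    finally show ?thesis using l(2) alD by linarith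
  qed
  moreover have "modulus (pprt (f (Suc k) - f k)) \<le> modulus (y k) + u k" for k
  proof -
    have "f (Suc k) - f k = (f (Suc k) - l\<^sup>2 *\<^sub>R f k - (\<alpha> * l) *\<^sub>R w k) + u k"
      by (simp add: u_def scaleR_diff_left)
    then have "pprt (f (Suc k) - f k) \<le> y k + pprt (u k)"
      unfolding y_def by (simp only: pprt_add)
    then show ?thesis using u0[of k] by (simp add: y_def)
  qed
  ultimately show "\<exists>y u. null y \<and> (\<forall>k. 0 \<le> u k \<and> norm (u k) \<le> b \<and>
      modulus (pprt (f (Suc k) - f k)) \<le> modulus (y k) + u k)"
    using u0 by blast
qed

text \<open>An Archimedean argument. The decrements \<open>p\<close> form a nonnegative asymptotic
  orbit themselves, so the increment bound applied to them shows that they almost decrease. Each of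
  the \<open>J\<close> decrements leading from \<open>x k\<close> to \<open>x (k + J)\<close> is
  therefore almost at least \<open>p (k + J)\<close>, and as \<open>x\<close> stays nonnegative,
  \<open>real J *\<^sub>R p (k + J)\<close> is at most \<open>x k\<close> up to a null error, for
  every \<open>J\<close>.\<close>

lemma power_diff_tendsto_nonneg:
  assumes f: "0 \<le> f"
  shows "(\<lambda>n. (T ^^ n) (f - T f)) \<longlonglongrightarrow> 0"
proof -
  define x where "x k = (T ^^ k) f" for k
  define p where "p k = pprt (x k - x (Suc k))" for k
  define q where "q k = pprt (x (Suc k) - x k)" for k
  define r where "r k = pprt (p (Suc k) - p k)" for k
  have x0: "0 \<le> x k" and p0: "0 \<le> p k" for k by (simp_all add: x_def p_def f pos_power)
  have x: "asymp_orbit x" unfolding x_def by (rule asymp_orbit_power)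
  have p: "asymp_orbit p"
    unfolding p_def by (intro asymp_orbit_pprt asymp_orbit_diff asymp_orbit_shift x)
  have q: "null q" unfolding q_def by (rule null_pprt_increment[OF x x0])
  have r: "null r" unfolding r_def by (rule null_pprt_increment[OF p p0])
  have pq: "p k + x (Suc k) = x k + q k" for k
  proof -
    have "p k - q k = x k - x (Suc k)"
      using pprt_diff_eq[of "x k - x (Suc k)"] by (simp add: p_def q_def)
    then show ?thesis by (metis add.commute diff_add_cancel diff_add_eq)
  qed
  have main: "\<exists>n. null n \<and> (\<forall>k. real J *\<^sub>R p (k + J) + x (k + J) \<le> x k + n k)" for J
  proof (induction J)
    case 0
    show ?case using null_zero by (intro exI[of _ "\<lambda>k. 0"]) simp
  next
    case (Suc J)
    then obtain n where n: "null n" "\<And>k. real J *\<^sub>R p (k + J) + x (k + J) \<le> x k + n k" by blast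
    define n' where "n' k = n k + (q (k + J) + real (Suc J) *\<^sub>R r (k + J))" for k
    have "null n'" unfolding n'_def
      using q r n by (intro null_add null_scaleR) (simp_all add: null_shift_add_iff)
    moreover have "real (Suc J) *\<^sub>R p (k + Suc J) + x (k + Suc J) \<le> x k + n' k" for k
    proof -
      have "p (k + Suc J) \<le> p (k + J) + r (k + J)"
        using le_pprt[of "p (Suc (k + J)) - p (k + J)"] by (simp add: r_def diff_le_eq add.commute)
      then have "real (Suc J) *\<^sub>R p (k + Suc J) \<le> real (Suc J) *\<^sub>R (p (k + J) + r (k + J))"
        by (intro scaleR_left_mono) simp_all
      then have "real (Suc J) *\<^sub>R p (k + Suc J) + x (k + Suc J)
          \<le> real (Suc J) *\<^sub>R (p (k + J) + r (k + J)) + x (k + Suc J)"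
        by (rule add_right_mono)
      also have "\<dots> = real J *\<^sub>R p (k + J) + (p (k + J) + x (Suc (k + J))) + real (Suc J) *\<^sub>R r (k + J)"
        by (simp add: scaleR_add_right scaleR_add_left)
      also have "\<dots> = (real J *\<^sub>R p (k + J) + x (k + J)) + (q (k + J) + real (Suc J) *\<^sub>R r (k + J))"
        unfolding pq by (simp only: add.assoc)
      also have "\<dots> \<le> (x k + n k) + (q (k + J) + real (Suc J) *\<^sub>R r (k + J))"
        by (rule add_right_mono[OF n(2)])
      also have "\<dots> = x k + n' k" by (simp only: n'_def add.assoc)
      finally show ?thesis .
    qed
    ultimately show ?case by blast
  qed
  have est: "eventually (\<lambda>N. norm ((T ^^ N) (f - T f)) \<le> (M * norm f + 1) / real J) sequentially"
    if J: "0 < J" for J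
  proof -
    obtain n where n: "null n" "\<And>k. real J *\<^sub>R p (k + J) + x (k + J) \<le> x k + n k"
      using main by blast
    define n' where "n' k = n k + real J *\<^sub>R q (k + J)" for k
    have n': "null n'" unfolding n'_def
      using q n by (intro null_add null_scaleR) (simp_all add: null_shift_add_iff)
    define d where "d k = x (k + J) - x (Suc (k + J))" for k
    have d: "real J *\<^sub>R modulus (d k) \<le> x k + modulus (n' k)" for k
    proof -
      have "modulus (d k) = p (k + J) + q (k + J)"
        by (simp add: modulus_eq_pprt d_def p_def q_def)
      then have "real J *\<^sub>R modulus (d k) = real J *\<^sub>R p (k + J) + real J *\<^sub>R q (k + J)"
        by (simp add: scaleR_add_right)
      also have "\<dots> \<le> (real J *\<^sub>R p (k + J) + x (k + J)) + real J *\<^sub>R q (k + J)"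
        using x0 by (intro add_right_mono) simp
      also have "\<dots> \<le> (x k + n k) + real J *\<^sub>R q (k + J)" by (rule add_right_mono[OF n(2)])
      also have "\<dots> = x k + n' k" by (simp only: n'_def add.assoc)
      also have "\<dots> \<le> x k + modulus (n' k)" by (intro add_left_mono modulus_ge)
      finally show ?thesis .
    qed
    have bound: "real J * norm ((T ^^ (N + J)) (f - T f))
        \<le> M * norm f + norm (acc (\<lambda>k. modulus (n' k)) (Suc N)) / real (Suc N)" for N
    proof -
      \<comment> \<open>\<open>d\<close> is an exact orbit, so its accumulated sum is a multiple of
        one vector and the averaged estimate becomes a pointwise one.\<close>
      have "d k = (T ^^ k) ((T ^^ J) (f - T f))" for k
      proof -
        have "d k = (T ^^ (k + J)) f - (T ^^ (k + J)) (T f)"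
          by (simp add: d_def x_def funpow_swap1)
        also have "\<dots> = (T ^^ (k + J)) (f - T f)"
          by (simp only: linear_simps(2)[OF bounded_linear_power])
        finally show ?thesis by (simp add: funpow_add)
      qed
      then have "d = (\<lambda>k. (T ^^ k) ((T ^^ J) (f - T f)))" by (rule ext)
      then have "acc d (Suc N) = real (Suc N) *\<^sub>R (T ^^ N) ((T ^^ J) (f - T f))"
        by (simp only: acc_orbit)
      then have "real J * (real (Suc N) * norm ((T ^^ (N + J)) (f - T f))) = norm (real J *\<^sub>R acc d (Suc N))"
        by (simp add: funpow_add del: acc.simps)
      also have "\<dots> = norm (acc (\<lambda>k. real J *\<^sub>R d k) (Suc N))" by (simp only: acc_scaleR)
      also have "\<dots> \<le> norm (acc (\<lambda>k. x k + modulus (n' k)) (Suc N))"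
      proof (rule norm_mono_modulus_le, rule modulus_least)
        have "real J *\<^sub>R d k \<le> x k + modulus (n' k)" "- (real J *\<^sub>R d k) \<le> x k + modulus (n' k)" for k
        proof -
          have "real J *\<^sub>R d k \<le> real J *\<^sub>R modulus (d k)" "real J *\<^sub>R (- d k) \<le> real J *\<^sub>R modulus (d k)"
            by (intro scaleR_left_mono modulus_ge; simp)+
          then show "real J *\<^sub>R d k \<le> x k + modulus (n' k)" "- (real J *\<^sub>R d k) \<le> x k + modulus (n' k)"
            using d[of k] by (auto intro: order_trans)
        qed
        note dd = this
        show "acc (\<lambda>k. real J *\<^sub>R d k) (Suc N) \<le> acc (\<lambda>k. x k + modulus (n' k)) (Suc N)"
          by (rule acc_mono) (rule dd)
        have "acc (\<lambda>k. (-1) *\<^sub>R (real J *\<^sub>R d k)) (Suc N) \<le> acc (\<lambda>k. x k + modulus (n' k)) (Suc N)"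
          by (rule acc_mono) (use dd(2) in simp)
        then show "- acc (\<lambda>k. real J *\<^sub>R d k) (Suc N) \<le> acc (\<lambda>k. x k + modulus (n' k)) (Suc N)"
          unfolding acc_scaleR[of "-1"] by (simp del: acc.simps)
      qed
      also have "\<dots> \<le> norm (acc x (Suc N)) + norm (acc (\<lambda>k. modulus (n' k)) (Suc N))"
        unfolding acc_add by (rule norm_triangle_ineq)
      also have "acc x (Suc N) = real (Suc N) *\<^sub>R (T ^^ N) f"
        unfolding x_def by (rule acc_orbit)
      also have "norm \<dots> \<le> real (Suc N) * (M * norm f)"
        using power_bound[of N f] by (simp add: mult_left_mono del: of_nat_Suc)
      finally have "real (Suc N) * (real J * norm ((T ^^ (N + J)) (f - T f)))
          \<le> real (Suc N) * (M * norm f) + norm (acc (\<lambda>k. modulus (n' k)) (Suc N))"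
        by (simp only: mult.left_commute)
      then show ?thesis
        by (simp add: field_simps del: acc.simps of_nat_Suc)
    qed
    have "(\<lambda>N. norm (acc (\<lambda>k. modulus (n' k)) (Suc N)) / real (Suc N)) \<longlonglongrightarrow> 0"
      using n'[unfolded null_def] by (rule LIMSEQ_Suc)
    then have "eventually (\<lambda>N. norm (acc (\<lambda>k. modulus (n' k)) (Suc N)) / real (Suc N) < 1) sequentially"
      by (rule order_tendstoD) simp
    then have "eventually (\<lambda>N. norm ((T ^^ (N + J)) (f - T f)) \<le> (M * norm f + 1) / real J) sequentially"
    proof eventually_elim
      case (elim N)
      with bound[of N] have "real J * norm ((T ^^ (N + J)) (f - T f)) \<le> M * norm f + 1" by linarith
      then show ?case using J by (simp add: field_simps)
    qed
    then show ?thesis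
      by (rule eventually_sequentially_seg[THEN iffD1])
  qed
  show ?thesis
  proof (rule tendstoI)
    fix b :: real assume b: "0 < b"
    obtain J where J: "(M * norm f + 1) / b < real J" using reals_Archimedean2 by blast
    have "0 < (M * norm f + 1) / b" using b M_nonneg by (simp add: add_nonneg_pos)
    with J have J0: "0 < J" by (metis of_nat_0_less_iff less_trans)
    have "(M * norm f + 1) / real J < b" using J J0 b by (simp add: field_simps)
    from est[OF J0] show "eventually (\<lambda>n. dist ((T ^^ n) (f - T f)) 0 < b) sequentially"
    proof eventually_elim
      case (elim n)
      with \<open>(M * norm f + 1) / real J < b\<close> show ?case unfolding dist_0_norm dist_commute[of _ 0] by linarith
    qed
  qed
qed

theorem power_diff_tendsto: "(\<lambda>n. (T ^^ n) (f - T f)) \<longlonglongrightarrow> 0"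
proof -
  have "(T ^^ n) (f - T f) = (T ^^ n) (pprt f - T (pprt f)) - (T ^^ n) (pprt (- f) - T (pprt (- f)))" for n
  proof -
    have "f - T f = (pprt f - T (pprt f)) - (pprt (- f) - T (pprt (- f)))"
    proof -
      have "(pprt f - T (pprt f)) - (pprt (- f) - T (pprt (- f)))
          = (pprt f - pprt (- f)) - T (pprt f - pprt (- f))"
        by (simp add: T_diff)
      then show ?thesis unfolding pprt_diff_eq by (rule sym)
    qed
    then show ?thesis by (simp only: linear_simps(2)[OF bounded_linear_power])
  qed
  then show ?thesis
    using tendsto_diff[OF power_diff_tendsto_nonneg[of "pprt f"] power_diff_tendsto_nonneg[of "pprt (- f)"]] by simp
qed

end

end

section \<open>Bounded semigroups\<close>

text \<open>The fundamental theorem is applied on \<open>{0..x + 1}\<close> to leave room to the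
  right of \<open>x\<close>.\<close>

lemma tendsto_right_difference_quotient_integral:
  fixes u :: "real \<Rightarrow> 'a::banach"
  assumes cont: "continuous_on {0..} u" and x: "0 \<le> x"
  shows "((\<lambda>h. (integral {0..x + h} u - integral {0..x} u) /\<^sub>R h) \<longlongrightarrow> u x) (at_right 0)"
proof -
  define G where "G y = integral {0..y} u" for y
  have "(G has_vector_derivative u x) (at x within {0..x + 1})"
    unfolding G_def using x
    by (intro integral_has_vector_derivative continuous_on_subset[OF cont]) auto
  then have *: "((\<lambda>y. norm ((G y - G x) - (y - x) *\<^sub>R u x) / norm (y - x)) \<longlongrightarrow> 0) (at x within {0..x + 1})"
    unfolding has_vector_derivative_def has_derivative_iff_norm by simp
  have "filterlim (\<lambda>h. x + h) (at x within {0..x + 1}) (at_right 0)"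
    unfolding filterlim_at
  proof
    have "eventually (\<lambda>h::real. h \<in> {0<..<1}) (at_right 0)"
      by (rule eventually_at_right_real) simp
    then show "eventually (\<lambda>h. x + h \<in> {0..x + 1} \<and> x + h \<noteq> x) (at_right 0)"
      by eventually_elim (use x in auto)
    show "((\<lambda>h. x + h) \<longlongrightarrow> x) (at_right 0)"
      using tendsto_add[OF tendsto_const[of x] tendsto_ident_at[of 0 "{0<..}"]] by simp
  qed
  from filterlim_compose[OF * this]
  have "((\<lambda>h. norm ((G (x + h) - G x) - h *\<^sub>R u x) / norm h) \<longlongrightarrow> 0) (at_right 0)" by simp
  moreover have "eventually (\<lambda>h. norm ((G (x + h) - G x) - h *\<^sub>R u x) / norm h
      = norm ((G (x + h) - G x) /\<^sub>R h - u x)) (at_right 0)"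
    using eventually_at_right_less[of 0]
  proof eventually_elim
    case (elim h)
    have "(G (x + h) - G x) /\<^sub>R h - u x = ((G (x + h) - G x) - h *\<^sub>R u x) /\<^sub>R h"
      using elim by (simp add: scaleR_diff_right)
    then show ?case using elim by (simp add: divide_inverse mult.commute)
  qed
  ultimately have "((\<lambda>h. norm ((G (x + h) - G x) /\<^sub>R h - u x)) \<longlongrightarrow> 0) (at_right 0)"
    by (rule Lim_transform_eventually)
  then show ?thesis
    unfolding G_def by (simp only: tendsto_norm_zero_iff LIM_zero_iff)
qed

locale bounded_C0_semigroup =
  fixes S :: "real \<Rightarrow> ('a::banach \<Rightarrow>\<^sub>L 'a)" and M :: real
  assumes C0: "C0_semigroup S" and norm_S_le: "0 < t \<Longrightarrow> norm (S t) \<le> M"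
begin

lemma S_add: "0 < s \<Longrightarrow> 0 < t \<Longrightarrow> S (s + t) f = S s (S t f)"
  using C0 by (metis C0_semigroup_def add.commute blinfun_apply_blinfun_compose)

lemma S_strong_cont: "((\<lambda>t. S t f) \<longlongrightarrow> f) (at_right 0)"
  using C0 by (simp add: C0_semigroup_def)

lemma M_nonneg: "0 \<le> M"
  using norm_S_le[of 1] norm_ge_zero[of "S 1"] by linarith

lemma norm_S_apply: "0 < t \<Longrightarrow> norm (S t f) \<le> M * norm f"
  using norm_blinfun[of "S t" f] mult_right_mono[OF norm_S_le[of t], of "norm f"] by simp

lemma S_power: "0 < s \<Longrightarrow> (blinfun_apply (S s) ^^ Suc n) f = S (real (Suc n) * s) f"
proof (induction n)
  case (Suc n)
  have "(blinfun_apply (S s) ^^ Suc (Suc n)) f = S s (S (real (Suc n) * s) f)"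
    using Suc by simp
  also have "\<dots> = S (s + real (Suc n) * s) f" using Suc(2) by (simp add: S_add)
  finally show ?case by (simp add: algebra_simps)
qed simp

lemma S_Suc_mult:
  assumes "0 < h"
  shows "S (real (Suc (Suc n)) * h) f = S h (S (real (Suc n) * h) f)"
    "S (real (Suc (Suc n)) * h) f = S (real (Suc n) * h) (S h f)"
proof -
  have eq: "real (Suc (Suc n)) * h = h + real (Suc n) * h" by (simp add: algebra_simps)
  have "0 < real (Suc n) * h" using assms by simp
  then show "S (real (Suc (Suc n)) * h) f = S h (S (real (Suc n) * h) f)"
    "S (real (Suc (Suc n)) * h) f = S (real (Suc n) * h) (S h f)"
    using assms S_add[of h "real (Suc n) * h" f] S_add[of "real (Suc n) * h" h f]
    by (simp_all only: eq add.commute[of h])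
qed

lemma S_tendsto_at_right:
  assumes "0 < e"
  obtains d where "0 < d" "\<And>t. 0 < t \<Longrightarrow> t < d \<Longrightarrow> norm (S t f - f) < e"
proof -
  have "eventually (\<lambda>t. dist (S t f) f < e) (at_right 0)"
    using S_strong_cont assms by (rule tendstoD)
  then show ?thesis
    using that unfolding eventually_at_right_field dist_norm by blast
qed

text \<open>The axioms concern positive times only and leave \<open>S 0\<close> arbitrary. The value
  \<open>f\<close> at time 0 makes orbits continuous on \<open>{0..}\<close>, hence integrable from
  0.\<close>

definition orbit :: "'a \<Rightarrow> real \<Rightarrow> 'a" where
  "orbit f t = (if 0 < t then S t f else f)"

lemma S_orbit: "0 < s \<Longrightarrow> 0 \<le> t \<Longrightarrow> S s (orbit f t) = orbit f (s + t)"
  by (auto simp: orbit_def S_add)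

text \<open>The constant \<open>M + 1\<close> also covers \<open>s = 0\<close>, where the acting
  operator is the identity, and it is positive, so later estimates can divide by it.\<close>

lemma norm_orbit_diff_le:
  assumes "0 \<le> s" "s \<le> t"
  shows "norm (orbit f t - orbit f s) \<le> (M + 1) * norm (orbit f (t - s) - f)"
proof (cases "s = 0 \<or> s = t")
  case True
  then show ?thesis
    using assms M_nonneg by (auto simp: orbit_def mult_le_cancel_right1)
next
  case False
  then have "orbit f t - orbit f s = S s (orbit f (t - s) - f)"
    using assms S_orbit[of s "t - s" f] by (simp add: blinfun.diff_right) (simp add: orbit_def)
  then have "norm (orbit f t - orbit f s) \<le> M * norm (orbit f (t - s) - f)"
    using norm_S_apply[of s "orbit f (t - s) - f"] False assms by simp
  also have "\<dots> \<le> (M + 1) * norm (orbit f (t - s) - f)" by (intro mult_right_mono) auto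
  finally show ?thesis .
qed

lemma continuous_orbit: "continuous_on {0..} (orbit f)"
  unfolding continuous_on_iff
proof (intro ballI allI impI)
  fix x e :: real assume x: "x \<in> {0..}" and e: "0 < e"
  obtain d where d: "0 < d" "\<And>t. 0 < t \<Longrightarrow> t < d \<Longrightarrow> norm (S t f - f) < e / (M + 1)"
    using S_tendsto_at_right[of "e / (M + 1)" f] e M_nonneg by (metis add_nonneg_pos divide_pos_pos zero_less_one)
  have d': "norm (orbit f t - f) < e / (M + 1)" if "t < d" for t
    using d(2)[of t] that e M_nonneg by (auto simp: orbit_def)
  have key: "norm (orbit f t - orbit f s) < e" if "0 \<le> s" "s \<le> t" "t - s < d" for s t
  proof -
    have "norm (orbit f t - orbit f s) \<le> (M + 1) * norm (orbit f (t - s) - f)"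
      by (rule norm_orbit_diff_le) (use that in auto)
    also have "\<dots> < (M + 1) * (e / (M + 1))"
      using d'[OF that(3)] M_nonneg by (intro mult_strict_left_mono) auto
    also have "\<dots> = e" using M_nonneg by simp
    finally show ?thesis .
  qed
  have "dist (orbit f y) (orbit f x) < e" if "y \<in> {0..}" "dist y x < d" for y
    using key[of x y] key[of y x] x that
    by (cases "x \<le> y") (auto simp: dist_norm norm_minus_commute abs_if split: if_splits)
  with d(1) show "\<exists>d>0. \<forall>y\<in>{0..}. dist y x < d \<longrightarrow> dist (orbit f y) (orbit f x) < e"
    by blast
qed

text \<open>\<open>S h\<close> moves the window of integration to \<open>{h..t + h}\<close>, so the
  difference quotient is a difference of two short averages of the orbit, at \<open>t\<close> and at
  \<open>0\<close>.\<close>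

lemma integral_orbit_gen:
  assumes t: "0 < t"
  shows "integral {0..t} (orbit f) \<in> gen_dom S" "gen S (integral {0..t} (orbit f)) = S t f - f"
proof -
  define F where "F = integral {0..t} (orbit f)"
  have int: "orbit f integrable_on {a..b}" if "0 \<le> a" for a b
    using that by (intro integrable_continuous_interval continuous_on_subset[OF continuous_orbit]) auto
  have eq: "S h F - F = (integral {0..t + h} (orbit f) - integral {0..t} (orbit f))
      - (integral {0..0 + h} (orbit f) - integral {0..0} (orbit f))" if h: "0 < h" for h
  proof -
    have "S h F = integral {0..t} (blinfun_apply (S h) \<circ> orbit f)"
      unfolding F_def by (rule integral_linear[symmetric, OF int blinfun.bounded_linear_right]) simp
    also have "\<dots> = integral {0..t} (orbit f \<circ> (+) h)"
      using h by (intro integral_cong) (simp add: S_orbit)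
    also have "\<dots> = integral {h..t + h} (orbit f)"
      using integral_shift_Icc_real[of 0 t "orbit f" h] by simp
    also have "\<dots> = integral {0..t + h} (orbit f) - integral {0..h} (orbit f)"
      using Henstock_Kurzweil_Integration.integral_combine[where a = 0 and c = h and b = "t + h" and f = "orbit f"] h t int[of 0 "t + h"] by (simp add: algebra_simps)
    finally show ?thesis by (simp add: F_def)
  qed
  have "((\<lambda>h. (integral {0..t + h} (orbit f) - integral {0..t} (orbit f)) /\<^sub>R h
      - (integral {0..0 + h} (orbit f) - integral {0..0} (orbit f)) /\<^sub>R h) \<longlongrightarrow> orbit f t - orbit f 0) (at_right 0)"
    using t by (intro tendsto_diff tendsto_right_difference_quotient_integral continuous_orbit) auto
  moreover have "eventually (\<lambda>h. (integral {0..t + h} (orbit f) - integral {0..t} (orbit f)) /\<^sub>R h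
      - (integral {0..0 + h} (orbit f) - integral {0..0} (orbit f)) /\<^sub>R h = (S h F - F) /\<^sub>R h) (at_right 0)"
    using eventually_at_right_less[of 0]
    by eventually_elim (simp only: eq scaleR_diff_right)
  ultimately have "((\<lambda>h. (S h F - F) /\<^sub>R h) \<longlongrightarrow> orbit f t - orbit f 0) (at_right 0)"
    by (rule Lim_transform_eventually)
  then have lim: "((\<lambda>h. (S h F - F) /\<^sub>R h) \<longlongrightarrow> S t f - f) (at_right 0)"
    using t by (simp add: orbit_def)
  from lim show "F \<in> gen_dom S" by (auto simp: gen_dom_def)
  from lim show "gen S F = S t f - f"
    unfolding gen_def by (intro tendsto_Lim) simp_all
qed

text \<open>The adjoint condition speaks of the domain only. Testing it on integrals of orbits,
  which the generator maps to \<open>S t f - f\<close>, yields invariance under every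
  \<open>S t\<close>; the converse passes to the limit in difference quotients.\<close>

lemma dual_gen_ker_eq: "dual_gen_ker S = {\<phi>. \<forall>t>0. \<forall>f. blinfun_apply \<phi> (S t f) = \<phi> f}"
proof (intro set_eqI iffI)
  fix \<phi> assume "\<phi> \<in> dual_gen_ker S"
  then have *: "\<phi> (gen S f) = 0" if "f \<in> gen_dom S" for f
    using that by (simp add: dual_gen_ker_def dual_gen_rel_def)
  have "\<phi> (S t f - f) = 0" if "0 < t" for t f
    using *[OF integral_orbit_gen(1)[OF that, of f]] integral_orbit_gen(2)[OF that, of f] by simp
  then show "\<phi> \<in> {\<phi>. \<forall>t>0. \<forall>f. blinfun_apply \<phi> (S t f) = \<phi> f}" by (simp add: blinfun.diff_right)
next
  fix \<phi> :: "'a \<Rightarrow>\<^sub>L real" assume \<phi>: "\<phi> \<in> {\<phi>. \<forall>t>0. \<forall>f. blinfun_apply \<phi> (S t f) = \<phi> f}"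
  have "\<phi> (gen S f) = 0" if f: "f \<in> gen_dom S" for f
  proof -
    obtain g where g: "((\<lambda>t. (S t f - f) /\<^sub>R t) \<longlongrightarrow> g) (at_right 0)"
      using f by (auto simp: gen_dom_def)
    then have "gen S f = g" unfolding gen_def by (intro tendsto_Lim) simp_all
    have "((\<lambda>t. \<phi> ((S t f - f) /\<^sub>R t)) \<longlongrightarrow> \<phi> g) (at_right 0)"
      using g by (rule bounded_linear.tendsto[OF blinfun.bounded_linear_right])
    moreover have "eventually (\<lambda>t. \<phi> ((S t f - f) /\<^sub>R t) = 0) (at_right 0)"
      using eventually_at_right_less[of 0]
      by eventually_elim (use \<phi> in \<open>simp add: blinfun.scaleR_right blinfun.diff_right\<close>)
    ultimately have "((\<lambda>t. 0) \<longlongrightarrow> \<phi> g) (at_right (0::real))"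
      by (rule Lim_transform_eventually)
    then have "\<phi> g = 0"
      by (intro tendsto_unique[OF _ _ tendsto_const]) simp_all
    then show ?thesis using \<open>gen S f = g\<close> by simp
  qed
  then show "\<phi> \<in> dual_gen_ker S" by (simp add: dual_gen_ker_def dual_gen_rel_def)
qed

lemma norm_S_mult_diff_le:
  assumes "0 < h"
  shows "norm (S (real (Suc n) * h) f - f) \<le> real (Suc n) * ((M + 1) * norm (S h f - f))"
proof (induction n)
  case 0
  show ?case using M_nonneg by (simp add: mult_le_cancel_right1)
next
  case (Suc n)
  have "S (real (Suc (Suc n)) * h) f - f = S (real (Suc n) * h) (S h f - f) + (S (real (Suc n) * h) f - f)"
    unfolding S_Suc_mult(2)[OF assms] by (simp add: blinfun.diff_right)
  also have "norm \<dots> \<le> (M + 1) * norm (S h f - f) + real (Suc n) * ((M + 1) * norm (S h f - f))"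
  proof (intro order_trans[OF norm_triangle_ineq] add_mono Suc)
    have "norm (S (real (Suc n) * h) (S h f - f)) \<le> M * norm (S h f - f)"
      using assms by (intro norm_S_apply) simp
    also have "\<dots> \<le> (M + 1) * norm (S h f - f)" by (intro mult_right_mono) auto
    finally show "norm (S (real (Suc n) * h) (S h f - f)) \<le> (M + 1) * norm (S h f - f)" .
  qed
  finally show ?case by (simp add: algebra_simps)
qed

text \<open>Cutting \<open>[0, t]\<close> into equal steps \<open>h\<close> and telescoping bounds
  \<open>norm (S t f - f)\<close> by \<open>t * (M + 1)\<close> times the norm of the difference
  quotient at \<open>h\<close>, which tends to 0.\<close>

lemma gen_ker_eq: "gen_ker S = {f. \<forall>t>0. S t f = f}"
proof (intro set_eqI iffI)
  fix f assume "f \<in> {f. \<forall>t>0. S t f = f}"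
  then have "eventually (\<lambda>t. 0 = (S t f - f) /\<^sub>R t) (at_right 0)"
    using eventually_at_right_less[of 0] by (auto elim: eventually_mono)
  then have lim: "((\<lambda>t. (S t f - f) /\<^sub>R t) \<longlongrightarrow> 0) (at_right 0)"
    by (rule Lim_transform_eventually[OF tendsto_const])
  then have "gen S f = 0" unfolding gen_def by (intro tendsto_Lim) simp_all
  with lim show "f \<in> gen_ker S" by (auto simp: gen_ker_def gen_dom_def)
next
  fix f assume "f \<in> gen_ker S"
  then obtain g where g: "((\<lambda>t. (S t f - f) /\<^sub>R t) \<longlongrightarrow> g) (at_right 0)" "gen S f = 0"
    by (auto simp: gen_ker_def gen_dom_def)
  then have "g = 0" unfolding gen_def by (metis tendsto_Lim trivial_limit_at_right_real)
  with g have lim: "((\<lambda>t. (S t f - f) /\<^sub>R t) \<longlongrightarrow> 0) (at_right 0)" by simp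
  have "S t f = f" if t: "0 < t" for t
  proof -
    define h where "h n = t / real (Suc n)" for n
    have h0: "0 < h n" for n using t by (simp add: h_def)
    have "h \<longlonglongrightarrow> 0" unfolding h_def by (rule LIMSEQ_Suc[OF lim_const_over_n])
    then have "filterlim h (at_right 0) sequentially"
      unfolding filterlim_at using h0 by (auto intro!: always_eventually simp: less_imp_neq[symmetric])
    from tendsto_mult_right_zero[OF tendsto_norm_zero[OF filterlim_compose[OF lim this]], of "t * (M + 1)"]
    have lim': "(\<lambda>n. t * (M + 1) * norm ((S (h n) f - f) /\<^sub>R h n)) \<longlonglongrightarrow> 0" .
    have "norm (S t f - f) \<le> t * (M + 1) * norm ((S (h n) f - f) /\<^sub>R h n)" for n
    proof -
      have "norm (S t f - f) \<le> real (Suc n) * ((M + 1) * norm (S (h n) f - f))"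
        using norm_S_mult_diff_le[OF h0, of n n f] by (simp add: h_def)
      also have "\<dots> = t * (M + 1) * norm ((S (h n) f - f) /\<^sub>R h n)"
      proof -
        have "real (Suc n) = t * inverse (h n)" using t by (simp add: h_def)
        moreover have "norm ((S (h n) f - f) /\<^sub>R h n) = inverse (h n) * norm (S (h n) f - f)"
          using h0[of n] by simp
        ultimately show ?thesis by (simp only: mult_ac)
      qed
      finally show ?thesis .
    qed
    then have "norm (S t f - f) \<le> 0"
      by (intro LIMSEQ_le_const[OF lim']) auto
    then show ?thesis by simp
  qed
  then show "f \<in> {f. \<forall>t>0. S t f = f}" by simp
qed

section \<open>Vectors whose orbits tend to 0\<close>

definition decays :: "'a \<Rightarrow> bool" where
  "decays g \<longleftrightarrow> ((\<lambda>t. S t g) \<longlongrightarrow> 0) at_top"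

text \<open>One small value suffices, since all later values are at most \<open>M\<close> times as
  large.\<close>

lemma decaysI:
  assumes "\<And>e. 0 < e \<Longrightarrow> \<exists>t>0. norm (S t g) \<le> e"
  shows "decays g"
  unfolding decays_def
proof (rule tendstoI)
  fix e :: real assume e: "0 < e"
  obtain t where t: "0 < t" "norm (S t g) \<le> e / (M + 1)"
    using assms[of "e / (M + 1)"] e M_nonneg by auto
  have "eventually (\<lambda>s. t < s) at_top" by (rule eventually_gt_at_top)
  then show "eventually (\<lambda>s. dist (S s g) 0 < e) at_top"
  proof eventually_elim
    case (elim s)
    have "norm (S s g) = norm (S (s - t) (S t g))"
      using S_add[of "s - t" t g] t elim by simp
    also have "\<dots> \<le> M * norm (S t g)" using elim by (intro norm_S_apply) simp
    also have "\<dots> \<le> M * (e / (M + 1))" by (intro mult_left_mono t M_nonneg)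
    also have "\<dots> < e" using e M_nonneg by (simp add: field_simps)
    finally show ?case by simp
  qed
qed

lemma decaysD:
  assumes "decays g" "0 < e"
  shows "\<exists>t>0. norm (S t g) \<le> e"
proof -
  have "eventually (\<lambda>t. dist (S t g) 0 < e) at_top"
    using assms unfolding decays_def by (rule tendstoD)
  then have "eventually (\<lambda>t. 0 < t \<and> norm (S t g) \<le> e) at_top"
    using eventually_gt_at_top[of 0] by eventually_elim simp
  then show ?thesis using eventually_happens'[OF trivial_limit_at_top_linorder] by blast
qed

lemma decays_add: "decays g \<Longrightarrow> decays h \<Longrightarrow> decays (g + h)"
  unfolding decays_def by (drule (1) tendsto_add) (simp add: blinfun.add_right)

lemma decays_minus: "decays g \<Longrightarrow> decays (- g)"
  unfolding decays_def by (drule tendsto_minus) (simp add: blinfun.minus_right)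

lemma decays_closed:
  assumes "\<And>e. 0 < e \<Longrightarrow> \<exists>h. decays h \<and> norm (g - h) \<le> e"
  shows "decays g"
proof (rule decaysI)
  fix e :: real assume e: "0 < e"
  have "0 < e / (2 * (M + 1))" using e M_nonneg by simp
  then obtain h where h: "decays h" "norm (g - h) \<le> e / (2 * (M + 1))" using assms by blast
  obtain t where t: "0 < t" "norm (S t h) \<le> e / 2" using decaysD[OF h(1), of "e / 2"] e by auto
  have "norm (S t g) \<le> norm (S t (g - h)) + norm (S t h)"
    using norm_triangle_ineq[of "S t (g - h)" "S t h"] by (simp add: blinfun.diff_right)
  also have "norm (S t (g - h)) \<le> M * norm (g - h)" using t by (intro norm_S_apply)
  also have "\<dots> \<le> M * (e / (2 * (M + 1)))" by (intro mult_left_mono h M_nonneg)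
  also have "\<dots> \<le> e / 2" using e M_nonneg by (simp add: field_simps)
  finally show "\<exists>t>0. norm (S t g) \<le> e" using t by (intro exI[of _ t]) auto
qed

end

section \<open>Decay of \<open>S r f - f\<close> under norm continuity\<close>

locale bounded_positive_semigroup = bounded_C0_semigroup S M
  for S :: "real \<Rightarrow> ('a::banach_lattice \<Rightarrow>\<^sub>L 'a)" and M +
  assumes pos_S: "0 < t \<Longrightarrow> 0 \<le> f \<Longrightarrow> 0 \<le> S t f"
begin

lemma power_bounded_S: "0 < h \<Longrightarrow> power_bounded_positive (blinfun_apply (S h)) (M + 1)"
proof (rule power_bounded_positive.intro)
  fix n f assume h: "0 < h"
  show "norm ((blinfun_apply (S h) ^^ n) f) \<le> (M + 1) * norm f"
  proof (cases n)
    case 0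
    then show ?thesis using M_nonneg by (simp add: mult_le_cancel_right1)
  next
    case (Suc k)
    have "norm ((blinfun_apply (S h) ^^ n) f) \<le> M * norm f"
      unfolding Suc S_power[OF h] using h by (intro norm_S_apply) simp
    also have "\<dots> \<le> (M + 1) * norm f" by (intro mult_right_mono) auto
    finally show ?thesis .
  qed
qed (use M_nonneg in \<open>auto simp: pos_S blinfun.bounded_linear_right\<close>)

text \<open>For \<open>T = S h\<close> the times \<open>t\<close> and \<open>t + h\<close> belong to
  the exponents \<open>Suc m\<close> and \<open>Suc (Suc m)\<close>, so norm closeness of
  \<open>S\<close> is the gap required of the powers, with \<open>e = 1/2\<close>.\<close>

lemma decays_small_step:
  assumes t: "t = real (Suc m) * h" and h: "0 < h" and gap: "norm (S (t + h) - S t) \<le> 1 / 2"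
  shows "decays (S h f - f)"
proof -
  interpret T: power_bounded_positive "blinfun_apply (S h)" "M + 1"
    using h by (rule power_bounded_S)
  have "(\<lambda>n. (blinfun_apply (S h) ^^ n) (f - S h f)) \<longlonglongrightarrow> 0"
  proof (rule T.power_diff_tendsto[where m = "Suc m" and e = "1/2"])
    fix f
    have "(blinfun_apply (S h) ^^ Suc (Suc m)) f - (blinfun_apply (S h) ^^ Suc m) f = (S (t + h) - S t) f"
      unfolding S_power[OF h] t by (simp add: blinfun.diff_left algebra_simps)
    also have "norm \<dots> \<le> norm (S (t + h) - S t) * norm f" by (rule norm_blinfun)
    also have "\<dots> \<le> 1 / 2 * norm f" by (intro mult_right_mono gap) simp
    finally show "norm ((blinfun_apply (S h) ^^ Suc (Suc m)) f - (blinfun_apply (S h) ^^ Suc m) f)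
      \<le> 1 / 2 * norm f" .
  qed simp_all
  then have lim: "(\<lambda>n. S (real (Suc n) * h) (f - S h f)) \<longlonglongrightarrow> 0"
    unfolding S_power[OF h, symmetric] by (rule LIMSEQ_Suc)
  have "decays (f - S h f)"
  proof (rule decaysI)
    fix e :: real assume "0 < e"
    with lim obtain n where "norm (S (real (Suc n) * h) (f - S h f)) < e"
      by (metis LIMSEQ_D diff_zero order_refl)
    then show "\<exists>t>0. norm (S t (f - S h f)) \<le> e"
      using h by (intro exI[of _ "real (Suc n) * h"]) simp
  qed
  from decays_minus[OF this] show ?thesis by simp
qed

lemma decays_multiple_step:
  assumes h: "0 < h" and step: "\<And>f. decays (S h f - f)"
  shows "decays (S (real (Suc k) * h) f - f)"
proof (induction k)
  case 0
  show ?case using step by simp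
next
  case (Suc k)
  have "S (real (Suc (Suc k)) * h) f = S h (S (real (Suc k) * h) f)"
    by (rule S_Suc_mult[OF h])
  with decays_add[OF step[of "S (real (Suc k) * h) f"] Suc] show ?case by simp
qed

text \<open>The gap occurs only beyond \<open>t0\<close>, and for steps \<open>h\<close> of which
  such a time is a multiple. These steps can be taken arbitrarily small, so their multiples approach
  \<open>r\<close>; strong continuity and closedness of the decaying vectors then cover
  \<open>r\<close> itself.\<close>

theorem decays_diff:
  assumes enc: "eventually_norm_continuous S" and r: "0 < r"
  shows "decays (S r f - f)"
proof (rule decays_closed)
  fix e :: real assume e: "0 < e"
  obtain t0 where t0: "0 \<le> t0" "continuous_on {t0<..} S"
    using enc by (auto simp: eventually_norm_continuous_def)
  define t where "t = t0 + 1"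
  obtain d where d: "0 < d" "\<And>s. s \<in> {t0<..} \<Longrightarrow> dist s t < d \<Longrightarrow> dist (S s) (S t) < 1/2"
    using t0(2) unfolding continuous_on_iff t_def
    by (metis add_strict_increasing greaterThan_iff less_add_one zero_less_divide_1_iff zero_less_numeral)
  have "0 < e / (M + 1)" using e M_nonneg by simp
  then obtain d' where d': "0 < d'" "\<And>t. 0 < t \<Longrightarrow> t < d' \<Longrightarrow> norm (S t f - f) < e / (M + 1)"
    by (rule S_tendsto_at_right[of _ f]) blast
  \<comment> \<open>The three bounds on \<open>h\<close> serve norm continuity at \<open>t\<close>,
    strong continuity at 0, and the existence of a positive multiple of \<open>h\<close> not
    exceeding \<open>r\<close>.\<close>
  define b where "b = min (min d d') r"
  have b: "0 < b" using d d' r by (simp add: b_def)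
  obtain m where m: "t / b < real m" using reals_Archimedean2 by blast
  define h where "h = t / real (Suc m)"
  have tpos: "0 < t" using t0 by (simp add: t_def)
  have h: "0 < h" using tpos by (simp add: h_def)
  have th: "t = real (Suc m) * h" by (simp add: h_def)
  have "t / b < real (Suc m)" using m by simp
  then have hb: "h < b" using b tpos by (simp add: h_def field_simps)
  have "norm (S (t + h) - S t) \<le> 1 / 2"
    using d(2)[of "t + h"] hb h b_def tpos t_def by (simp add: dist_norm)
  then have step: "decays (S h g - g)" for g
    by (rule decays_small_step[OF th h])
  define k where "k = nat \<lfloor>r / h\<rfloor>"
  have rh: "1 \<le> r / h" using hb h by (simp add: b_def)
  then have "1 \<le> k" unfolding k_def by linarith
  then obtain k' where k': "k = Suc k'" by (cases k) auto
  have "real k \<le> r / h" "r / h < real k + 1" unfolding k_def using rh by linarith+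
  then have kh: "real k * h \<le> r" "r - real k * h < h" using h by (simp_all add: field_simps)
  define s where "s = real k * h"
  have s: "0 < s" "s \<le> r" "r - s < d'" using h kh k' hb by (auto simp: s_def b_def)
  have "decays (S s f - f)"
    unfolding s_def k' by (rule decays_multiple_step[OF h step])
  moreover have "norm ((S r f - f) - (S s f - f)) \<le> e"
  proof -
    have "norm (orbit f r - orbit f s) \<le> (M + 1) * norm (orbit f (r - s) - f)"
      using s by (intro norm_orbit_diff_le) auto
    also have "\<dots> \<le> (M + 1) * (e / (M + 1))"
    proof (rule mult_left_mono)
      show "norm (orbit f (r - s) - f) \<le> e / (M + 1)"
        using d'(2)[of "r - s"] s e M_nonneg by (auto simp: orbit_def)
    qed (use M_nonneg in simp)
    also have "\<dots> = e" using M_nonneg by simp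
    finally show ?thesis using r s by (simp add: orbit_def)
  qed
  ultimately show "\<exists>g. decays g \<and> norm ((S r f - f) - g) \<le> e" by blast
qed

end

section \<open>Fixed vectors and fixed functionals\<close>

text \<open>\<open>p x\<close> is the limit superior of \<open>n t x\<close> at infinity. It is
  handled through eventual bounds: two of them hold simultaneously after the later of their times,
  whence subadditivity.\<close>

lemma sublinear_eventual_sup:
  fixes n :: "real \<Rightarrow> 'a::real_normed_vector \<Rightarrow> real"
  assumes sub: "\<And>t. 0 < t \<Longrightarrow> sublinear (n t)"
    and bound: "\<And>t x. 0 < t \<Longrightarrow> 0 \<le> n t x \<and> n t x \<le> C * norm x"
  defines "p \<equiv> \<lambda>x. INF t\<in>{0<..}. SUP s\<in>{t<..}. n s x"
  shows "sublinear p"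
    and "\<And>x t c. 0 < t \<Longrightarrow> (\<And>s. t < s \<Longrightarrow> n s x \<le> c) \<Longrightarrow> p x \<le> c"
    and "\<And>x c. p x < c \<Longrightarrow> \<exists>t>0. \<forall>s>t. n s x < c"
proof -
  define a where "a t x = (SUP s\<in>{t<..}. n s x)" for t x
  have p: "p x = (INF t\<in>{0<..}. a t x)" for x by (simp add: p_def a_def)
  have bdd: "bdd_above ((\<lambda>s. n s x) ` {t<..})" if "0 < t" for t x
    using bound that by (intro bdd_aboveI2[where M = "C * norm x"]) auto
  have a_ub: "n s x \<le> a t x" if "0 < t" "t < s" for s t x
    unfolding a_def using that bdd by (intro cSUP_upper) auto
  have a_le: "a t x \<le> c" if "\<And>s. t < s \<Longrightarrow> n s x \<le> c" for t x c
    unfolding a_def using that by (intro cSUP_least) auto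
  have a0: "0 \<le> a t x" if "0 < t" for t x
    using a_ub[OF that, of "t + 1" x] bound[of "t + 1" x] that by simp
  have bdd': "bdd_below ((\<lambda>t. a t x) ` {0<..})" for x
    using a0 by (intro bdd_belowI2[where m = 0]) auto
  have p_lb: "p x \<le> a t x" if "0 < t" for t x
    unfolding p using that bdd' by (intro cINF_lower) auto
  show p_le: "p x \<le> c" if "0 < t" "\<And>s. t < s \<Longrightarrow> n s x \<le> c" for x t c
    using p_lb[OF that(1), of x] a_le[of t x c, OF that(2)] by linarith
  show small: "\<exists>t>0. \<forall>s>t. n s x < c" if c: "p x < c" for x c
  proof -
    have "\<exists>t\<in>{0<..}. a t x < c"
      using c unfolding p by (subst (asm) cINF_less_iff) (auto simp: bdd')
    then obtain t where "0 < t" "a t x < c" by auto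
    then show ?thesis using a_ub by (metis le_less_trans)
  qed
  have add: "p (x + y) \<le> p x + p y" for x y
  proof (rule field_le_epsilon)
    fix e :: real assume e: "0 < e"
    obtain t1 where t1: "0 < t1" "\<And>s. t1 < s \<Longrightarrow> n s x < p x + e / 2"
      using small[of x "p x + e / 2"] e by auto
    obtain t2 where t2: "0 < t2" "\<And>s. t2 < s \<Longrightarrow> n s y < p y + e / 2"
      using small[of y "p y + e / 2"] e by auto
    show "p (x + y) \<le> p x + p y + e"
    proof (rule p_le[of "max t1 t2"])
      fix s assume s: "max t1 t2 < s"
      then have "n s (x + y) \<le> n s x + n s y"
        using t1(1) by (intro sublinearD(1) sub) auto
      then show "n s (x + y) \<le> p x + p y + e" using t1(2)[of s] t2(2)[of s] s by simp
    qed (use t1 in auto)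
  qed
  have scale_le: "p (r *\<^sub>R x) \<le> r * p x" if r: "0 < r" for r x
  proof (rule field_le_epsilon)
    fix e :: real assume e: "0 < e"
    obtain t where t: "0 < t" "\<And>s. t < s \<Longrightarrow> n s x < p x + e / r"
      using small[of x "p x + e / r"] e r by auto
    show "p (r *\<^sub>R x) \<le> r * p x + e"
    proof (rule p_le[OF t(1)])
      fix s assume s: "t < s"
      have "n s (r *\<^sub>R x) = r * n s x" using t s r by (intro sublinearD(2) sub) auto
      also have "\<dots> \<le> r * (p x + e / r)" using t(2)[OF s] r by (intro mult_left_mono) auto
      also have "\<dots> = r * p x + e" using r by (simp add: algebra_simps)
      finally show "n s (r *\<^sub>R x) \<le> r * p x + e" .
    qed
  qed
  have "p (r *\<^sub>R x) = r * p x" if r: "0 < r" for r x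
  proof -
    have "p (inverse r *\<^sub>R (r *\<^sub>R x)) \<le> inverse r * p (r *\<^sub>R x)" using r by (intro scale_le) auto
    then have "r * p x \<le> p (r *\<^sub>R x)" using r by (simp add: field_simps)
    with scale_le[OF r, of x] show ?thesis by simp
  qed
  with add show "sublinear p" by (auto simp: sublinear_def)
qed

text \<open>The distance of the positive part of \<open>x\<close> to the ideal generated by \<open>u\<close>.\<close>

lemma sublinear_ideal_distance:
  fixes u :: "'a::banach_lattice"
  assumes u: "0 \<le> u"
  defines "p \<equiv> \<lambda>x. INF c\<in>{0..}. norm (pprt (x - c *\<^sub>R u))"
  shows "sublinear p"
    and "\<And>x c. 0 \<le> c \<Longrightarrow> p x \<le> norm (pprt (x - c *\<^sub>R u))"
    and "\<And>x e. p x < e \<Longrightarrow> \<exists>c\<ge>0. norm (pprt (x - c *\<^sub>R u)) < e"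
proof -
  have bdd: "bdd_below ((\<lambda>c. norm (pprt (x - c *\<^sub>R u))) ` {0..})" for x
    by (intro bdd_belowI2[where m = 0]) simp
  show lb: "p x \<le> norm (pprt (x - c *\<^sub>R u))" if "0 \<le> c" for x c
    unfolding p_def using that bdd by (intro cINF_lower) auto
  show small: "\<exists>c\<ge>0. norm (pprt (x - c *\<^sub>R u)) < e" if c: "p x < e" for x e
    using c unfolding p_def by (subst (asm) cINF_less_iff) (auto simp: bdd)
  have add: "p (x + y) \<le> p x + p y" for x y
  proof (rule field_le_epsilon)
    fix e :: real assume e: "0 < e"
    obtain c where c: "0 \<le> c" "norm (pprt (x - c *\<^sub>R u)) < p x + e / 2"
      using small[of x "p x + e / 2"] e by auto
    obtain d where d: "0 \<le> d" "norm (pprt (y - d *\<^sub>R u)) < p y + e / 2"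
      using small[of y "p y + e / 2"] e by auto
    have "p (x + y) \<le> norm (pprt (x + y - (c + d) *\<^sub>R u))"
      using c d by (intro lb) simp
    also have "x + y - (c + d) *\<^sub>R u = (x - c *\<^sub>R u) + (y - d *\<^sub>R u)"
      by (simp add: scaleR_add_left)
    also have "norm (pprt \<dots>) \<le> norm (pprt (x - c *\<^sub>R u) + pprt (y - d *\<^sub>R u))"
      by (intro norm_mono_nonneg zero_le_pprt pprt_add)
    also have "\<dots> \<le> norm (pprt (x - c *\<^sub>R u)) + norm (pprt (y - d *\<^sub>R u))"
      by (rule norm_triangle_ineq)
    finally show "p (x + y) \<le> p x + p y + e" using c d by simp
  qed
  have scale_le: "p (r *\<^sub>R x) \<le> r * p x" if r: "0 < r" for r x
  proof (rule field_le_epsilon)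
    fix e :: real assume e: "0 < e"
    obtain c where c: "0 \<le> c" "norm (pprt (x - c *\<^sub>R u)) < p x + e / r"
      using small[of x "p x + e / r"] e r by auto
    have "p (r *\<^sub>R x) \<le> norm (pprt (r *\<^sub>R x - (r * c) *\<^sub>R u))"
      using c r by (intro lb) simp
    also have "r *\<^sub>R x - (r * c) *\<^sub>R u = r *\<^sub>R (x - c *\<^sub>R u)" by (simp add: scaleR_diff_right)
    also have "norm (pprt \<dots>) = r * norm (pprt (x - c *\<^sub>R u))" using r by (simp add: pprt_scaleR)
    also have "\<dots> \<le> r * (p x + e / r)" using c r by (intro mult_left_mono) auto
    also have "\<dots> = r * p x + e" using r by (simp add: algebra_simps)
    finally show "p (r *\<^sub>R x) \<le> r * p x + e" .
  qed
  have "p (r *\<^sub>R x) = r * p x" if r: "0 < r" for r x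
  proof -
    have "p (inverse r *\<^sub>R (r *\<^sub>R x)) \<le> inverse r * p (r *\<^sub>R x)" using r by (intro scale_le) auto
    then have "r * p x \<le> p (r *\<^sub>R x)" using r by (simp add: field_simps)
    with scale_le[OF r, of x] show ?thesis by simp
  qed
  with add show "sublinear p" by (auto simp: sublinear_def)
qed

text \<open>If \<open>v\<close> violates the defining limit, \<open>pprt (v - n *\<^sub>R u)\<close>
  does not tend to 0 and \<open>v\<close> has positive distance from the ideal. A functional below
  this distance is positive, and the choice \<open>c = 1\<close> shows that it is at most 0 at
  \<open>u\<close>.\<close>

lemma exists_pos_functional_vanishing:
  fixes u :: "'a::banach_lattice"
  assumes u: "0 \<le> u" "\<not> quasi_interior u"
  obtains \<psi> where "pos_functional \<psi>" "\<psi> \<noteq> 0" "\<psi> u = 0"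
proof -
  define p where "p = (\<lambda>x. INF c\<in>{0..}. norm (pprt (x - c *\<^sub>R u)))"
  have pS: "sublinear p" unfolding p_def by (rule sublinear_ideal_distance(1)[OF u(1)])
  have p_le: "p x \<le> norm (pprt (x - c *\<^sub>R u))" if "0 \<le> c" for x c
    unfolding p_def by (rule sublinear_ideal_distance(2)[OF u(1) that])
  have p_small: "\<exists>c\<ge>0. norm (pprt (x - c *\<^sub>R u)) < e" if "p x < e" for x e
    using that unfolding p_def by (rule sublinear_ideal_distance(3)[OF u(1)])
  obtain v where v: "0 \<le> v" "\<not> (\<lambda>n. inf v (real n *\<^sub>R u)) \<longlonglongrightarrow> v"
    using u by (auto simp: quasi_interior_def)
  have "p v \<noteq> 0"
  proof
    assume pv: "p v = 0"
    have "(\<lambda>n. inf v (real n *\<^sub>R u)) \<longlonglongrightarrow> v"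
    proof (rule LIMSEQ_I)
      fix e :: real assume "0 < e"
      then obtain c where c: "0 \<le> c" "norm (pprt (v - c *\<^sub>R u)) < e" using p_small[of v e] pv by auto
      obtain n0 where n0: "c < real n0" using reals_Archimedean2 by blast
      have "norm (inf v (real n *\<^sub>R u) - v) < e" if "n0 \<le> n" for n
      proof -
        have "c *\<^sub>R u \<le> real n *\<^sub>R u"
          using n0 that u(1) by (intro scaleR_right_mono) auto
        then have "norm (pprt (v - real n *\<^sub>R u)) \<le> norm (pprt (v - c *\<^sub>R u))"
          by (intro norm_mono_nonneg zero_le_pprt pprt_mono diff_left_mono)
        then show ?thesis
          using c(2) by (simp only: norm_minus_commute[of "inf v (real n *\<^sub>R u)"] diff_inf_eq_pprt)
      qed
      then show "\<exists>no. \<forall>n\<ge>no. norm (inf v (real n *\<^sub>R u) - v) < e" by blast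
    qed
    with v(2) show False by blast
  qed
  have bound: "p x \<le> 1 * norm x" for x
    using p_le[of 0 x] norm_pprt_le[of x] by simp
  obtain \<psi> :: "'a \<Rightarrow>\<^sub>L real" where \<psi>: "\<And>x. \<psi> x \<le> p x" "\<psi> v = p v"
    using Hahn_Banach_bounded[OF pS bound] by metis
  have pos: "0 \<le> \<psi> x" if "0 \<le> x" for x
    using \<psi>(1)[of "- x"] p_le[of 0 "- x"] that by (simp add: blinfun.minus_right)
  have "\<psi> u \<le> 0"
    using \<psi>(1)[of u] p_le[of 1 u] by simp
  then have "\<psi> u = 0" using pos[OF u(1)] by simp
  moreover have "\<psi> \<noteq> 0" using \<psi>(2) \<open>p v \<noteq> 0\<close> by auto
  moreover have "pos_functional \<psi>" using pos by (simp add: pos_functional_def)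
  ultimately show ?thesis using that by blast
qed

section \<open>Dimensions 0, 1 and at least 2\<close>

lemma edim_zero: "edim {0} = 0"
proof -
  have "\<exists>B. finite B \<and> independent B \<and> span B = span {0::'a}"
    by (intro exI[of _ "{}"]) (simp add: independent_empty)
  moreover have "dim {0::'a} = 0" using dim_eq_card[of "{}" "{0::'a}"] by (simp add: independent_empty)
  ultimately show ?thesis by (simp add: edim_def zero_enat_def)
qed

lemma edim_span_singleton:
  assumes "u \<noteq> 0"
  shows "edim (span {u}) = 1"
proof -
  have ind: "independent {u}" using assms by simp
  then have "\<exists>B. finite B \<and> independent B \<and> span B = span (span {u})"
    by (intro exI[of _ "{u}"]) (simp add: span_span)
  moreover have "dim (span {u}) = 1" using dim_span_eq_card_independent[OF ind] by simp
  ultimately show ?thesis by (simp add: edim_def one_enat_def)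
qed

text \<open>Without a finite basis \<open>edim\<close> is \<open>\<infinity>\<close>; with one, an
  independent set is no larger than the basis.\<close>

lemma edim_ge_2:
  assumes "a \<in> V" "b \<in> V" "a \<notin> span {b}" "b \<noteq> 0"
  shows "2 \<le> edim V"
proof (cases "\<exists>B. finite B \<and> independent B \<and> span B = span V")
  case True
  then obtain B where B: "finite B" "independent B" "span B = span V" by blast
  have ind: "independent {a, b}" using assms by (intro independent_insertI) (simp_all add: independent_empty)
  have "a \<noteq> b" using assms span_base[of b "{b}"] by auto
  have "{a, b} \<subseteq> span B" using assms B(3) by (auto intro: span_base)
  then have "card {a, b} \<le> card B"
    using independent_span_bound[OF B(1) ind] by simp
  then have "2 \<le> card B" using \<open>a \<noteq> b\<close> by simp
  moreover have "dim V = card B" using dim_eq_card[OF B(3,2)] .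
  ultimately show ?thesis using True by (simp add: edim_def numeral_eq_enat)
next
  case False
  then have "edim V = \<infinity>" unfolding edim_def by (rule if_not_P)
  then show ?thesis by simp
qed

section \<open>Fixed points of irreducible semigroups\<close>

locale irreducible_bounded_semigroup = bounded_positive_semigroup +
  assumes irred: "irreducible_semigroup S" and enc: "eventually_norm_continuous S"
begin

lemma dual_fixedD: "\<phi> \<in> dual_gen_ker S \<Longrightarrow> 0 < t \<Longrightarrow> \<phi> (S t f) = \<phi> f"
  by (simp add: dual_gen_ker_eq)

lemma fixedD: "u \<in> gen_ker S \<Longrightarrow> 0 < t \<Longrightarrow> S t u = u"
  by (simp add: gen_ker_eq)

lemma dual_fixed_tendsto:
  assumes \<phi>: "\<phi> \<in> dual_gen_ker S" and lim: "((\<lambda>t. S t f) \<longlongrightarrow> g) at_top"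
  shows "\<phi> f = \<phi> g"
proof -
  have "((\<lambda>t. \<phi> (S t f)) \<longlongrightarrow> \<phi> g) at_top"
    using lim by (rule bounded_linear.tendsto[OF blinfun.bounded_linear_right])
  moreover have "eventually (\<lambda>t. \<phi> (S t f) = \<phi> f) at_top"
    using eventually_gt_at_top[of 0] by eventually_elim (rule dual_fixedD[OF \<phi>])
  ultimately have "((\<lambda>t::real. \<phi> f) \<longlongrightarrow> \<phi> g) at_top"
    by (rule Lim_transform_eventually)
  then show ?thesis
    by (rule tendsto_unique[OF trivial_limit_at_top_linorder tendsto_const])
qed

text \<open>A functional dominated by \<open>p g = limsup \<parallel>(S t g)\<^sup>+\<parallel>\<close> is positive, and it is fixed because \<open>p\<close> vanishes
  at all \<open>\<plusminus> (S t f - f)\<close>.\<close>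

lemma exists_pos_fixed_functional:
  assumes g: "\<not> decays g"
  obtains \<psi> where "\<psi> \<in> dual_gen_ker S" "pos_functional \<psi>" "\<psi> g \<noteq> 0"
proof -
  define n where "n t x = norm (pprt (S t x))" for t x
  have nS: "sublinear (n t)" for t
    unfolding sublinear_def n_def
  proof (intro conjI allI impI)
    fix x y
    have "norm (pprt (S t x + S t y)) \<le> norm (pprt (S t x) + pprt (S t y))"
      by (intro norm_mono_nonneg zero_le_pprt pprt_add)
    also have "\<dots> \<le> norm (pprt (S t x)) + norm (pprt (S t y))" by (rule norm_triangle_ineq)
    finally show "norm (pprt (S t (x + y))) \<le> norm (pprt (S t x)) + norm (pprt (S t y))"
      by (simp only: blinfun.add_right)
  qed (simp add: blinfun.scaleR_right pprt_scaleR)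
  have nb: "0 \<le> n t x \<and> n t x \<le> M * norm x" if "0 < t" for t x
    using norm_pprt_le[of "S t x"] norm_S_apply[OF that, of x] by (simp add: n_def)
  define p where "p = (\<lambda>x. INF t\<in>{0<..}. SUP s\<in>{t<..}. n s x)"
  have pS: "sublinear p"
    unfolding p_def by (rule sublinear_eventual_sup(1)[OF nS nb])
  have p_le: "p x \<le> c" if "0 < t" "\<And>s. t < s \<Longrightarrow> n s x \<le> c" for x t c
    unfolding p_def by (rule sublinear_eventual_sup(2)[OF nS nb that(1)]) (auto intro: that(2))
  have p_small: "\<exists>t>0. \<forall>s>t. n s x < c" if "p x < c" for x c
    unfolding p_def by (rule sublinear_eventual_sup(3)[OF nS nb that[unfolded p_def]])
  have bound: "p x \<le> M * norm x" for x
    by (rule p_le[of 1]) (use nb in auto)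
  have p_neg: "p x \<le> 0" if "x \<le> 0" for x
  proof (rule p_le[of 1])
    fix s :: real assume "1 < s"
    then have "0 \<le> S s (- x)" using that by (intro pos_S) auto
    then have "pprt (S s x) = 0" by (intro pprt_eq_0) (simp add: blinfun.minus_right)
    then show "n s x \<le> 0" by (simp add: n_def)
  qed simp
  have p_decays: "p x \<le> 0" if "decays x" for x
  proof (rule field_le_epsilon)
    fix e :: real assume e: "0 < e"
    have "eventually (\<lambda>t. dist (S t x) 0 < e) at_top"
      using that e unfolding decays_def by (rule tendstoD)
    then obtain t where t: "\<And>s. t \<le> s \<Longrightarrow> norm (S s x) < e"
      by (auto simp: eventually_at_top_linorder)
    show "p x \<le> 0 + e"
    proof (rule p_le[of "max t 1"])
      fix s assume "max t 1 < s"
      then show "n s x \<le> 0 + e" using t[of s] norm_pprt_le[of "S s x"] by (simp add: n_def)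
    qed simp
  qed
  \<comment> \<open>If the positive parts of \<open>S t g\<close> and of its negative both became
    small, \<open>g\<close> would decay. So a functional attaining \<open>p\<close> at one of
    \<open>g\<close>, \<open>- g\<close> does not vanish there.\<close>
  have "p g > 0 \<or> p (- g) > 0"
  proof (rule ccontr)
    assume "\<not> (p g > 0 \<or> p (- g) > 0)"
    then have z: "p g \<le> 0" "p (- g) \<le> 0" by auto
    have "decays g"
    proof (rule decaysI)
      fix e :: real assume e: "0 < e"
      obtain t1 where t1: "0 < t1" "\<And>s. t1 < s \<Longrightarrow> n s g < e / 2"
        using p_small[of g "e / 2"] z e by auto
      obtain t2 where t2: "0 < t2" "\<And>s. t2 < s \<Longrightarrow> n s (- g) < e / 2"
        using p_small[of "- g" "e / 2"] z e by auto
      define s where "s = t1 + t2 + 1"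
      have "norm (S s g) = norm (pprt (S s g) - pprt (- S s g))" by (simp only: pprt_diff_eq)
      also have "\<dots> \<le> n s g + n s (- g)"
        unfolding n_def blinfun.minus_right by (rule norm_triangle_ineq4)
      also have "\<dots> \<le> e" using t1(1) t2(1) t1(2)[of s] t2(2)[of s] by (simp add: s_def)
      finally show "\<exists>t>0. norm (S t g) \<le> e"
        using t1(1) t2(1) by (intro exI[of _ s]) (simp add: s_def)
    qed
    with g show False by blast
  qed
  then obtain x0 where x0: "x0 = g \<or> x0 = - g" "0 < p x0" by blast
  obtain \<psi> :: "'a \<Rightarrow>\<^sub>L real" where \<psi>: "\<And>x. \<psi> x \<le> p x" "\<psi> x0 = p x0"
    using Hahn_Banach_bounded[OF pS bound] by metis
  have "\<psi> g \<noteq> 0" using \<psi>(2) x0 by (auto simp: blinfun.minus_right)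
  moreover have "0 \<le> \<psi> x" if "0 \<le> x" for x
    using order_trans[OF \<psi>(1) p_neg, of "- x"] that by (simp add: blinfun.minus_right)
  then have "pos_functional \<psi>" by (simp add: pos_functional_def)
  moreover have "\<psi> (S t f) = \<psi> f" if "0 < t" for t f
  proof -
    have d: "decays (S t f - f)" by (rule decays_diff[OF enc that])
    have "\<psi> (S t f - f) \<le> 0" "\<psi> (- (S t f - f)) \<le> 0"
      using order_trans[OF \<psi>(1) p_decays[OF d]] order_trans[OF \<psi>(1) p_decays[OF decays_minus[OF d]]] .
    then show ?thesis by (simp add: blinfun.diff_right)
  qed
  then have "\<psi> \<in> dual_gen_ker S" by (simp add: dual_gen_ker_eq)
  ultimately show ?thesis using that by blast
qed

lemma strictly_pos_of_fixed:
  assumes "\<phi> \<in> dual_gen_ker S" "pos_functional \<phi>" "\<phi> \<noteq> 0"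
  shows "strictly_pos_functional \<phi>"
  unfolding strictly_pos_functional_def
proof (intro allI impI)
  fix f :: 'a assume "0 \<le> f \<and> f \<noteq> 0"
  then obtain t where "0 < t" "0 < \<phi> (S t f)"
    using irred assms unfolding irreducible_semigroup_def by blast
  then show "0 < \<phi> f" using dual_fixedD[OF assms(1)] by simp
qed

lemma quasi_interior_of_fixed:
  assumes u: "u \<in> gen_ker S" "0 \<le> u" "u \<noteq> 0"
  shows "quasi_interior u"
proof (rule ccontr)
  assume "\<not> quasi_interior u"
  then obtain \<psi> where \<psi>: "pos_functional \<psi>" "\<psi> \<noteq> 0" "\<psi> u = 0"
    using exists_pos_functional_vanishing[OF u(2)] by blast
  then obtain t where "0 < t" "0 < \<psi> (S t u)"
    using irred u(2,3) unfolding irreducible_semigroup_def by blast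
  then show False using fixedD[OF u(1)] \<psi>(3) by simp
qed

text \<open>Positivity gives \<open>modulus u \<le> S t (modulus u)\<close>; \<open>\<phi>\<close>
  has the same value on both sides, and strict positivity excludes a difference.\<close>

lemma modulus_fixed:
  assumes \<phi>: "\<phi> \<in> dual_gen_ker S" "strictly_pos_functional \<phi>" and u: "u \<in> gen_ker S"
  shows "modulus u \<in> gen_ker S"
proof -
  have "S t (modulus u) = modulus u" if t: "0 < t" for t
  proof -
    define d where "d = S t (modulus u) - modulus u"
    have mono: "S t x \<le> S t y" if "x \<le> y" for x y
      using pos_S[OF t, of "y - x"] that by (simp add: blinfun.diff_right)
    have "modulus u \<le> S t (modulus u)"
    proof (rule modulus_least)
      show "u \<le> S t (modulus u)" using mono[OF modulus_ge(1)[of u]] fixedD[OF u t] by simp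
      show "- u \<le> S t (modulus u)"
        using mono[OF modulus_ge(2)[of u]] fixedD[OF u t] by (simp add: blinfun.minus_right)
    qed
    then have "0 \<le> d" by (simp add: d_def)
    moreover have "\<phi> d = 0" using dual_fixedD[OF \<phi>(1) t] by (simp add: d_def blinfun.diff_right)
    ultimately have "d = 0" using \<phi>(2) unfolding strictly_pos_functional_def by (metis less_irrefl)
    then show ?thesis by (simp add: d_def)
  qed
  then show ?thesis by (simp add: gen_ker_eq)
qed

lemma gen_ker_add: "u \<in> gen_ker S \<Longrightarrow> v \<in> gen_ker S \<Longrightarrow> u + v \<in> gen_ker S"
  and gen_ker_scaleR: "u \<in> gen_ker S \<Longrightarrow> r *\<^sub>R u \<in> gen_ker S"
  by (simp_all add: gen_ker_eq blinfun.add_right blinfun.scaleR_right)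

lemma pprt_fixed:
  assumes \<phi>: "\<phi> \<in> dual_gen_ker S" "strictly_pos_functional \<phi>" and u: "u \<in> gen_ker S"
  shows "pprt u \<in> gen_ker S"
  unfolding pprt_eq_half by (intro gen_ker_scaleR gen_ker_add modulus_fixed[OF \<phi>] u)

text \<open>The two parts are disjoint fixed vectors. If the negative one is nonzero it is
  quasi-interior, and only 0 is disjoint from a quasi-interior point.\<close>

lemma fixed_sign:
  assumes \<phi>: "\<phi> \<in> dual_gen_ker S" "strictly_pos_functional \<phi>" and u: "u \<in> gen_ker S"
  shows "pprt u = 0 \<or> pprt (- u) = 0"
proof (rule disjCI)
  assume ne: "pprt (- u) \<noteq> 0"
  have "- u \<in> gen_ker S" using gen_ker_scaleR[OF u, of "-1"] by simp
  then have "quasi_interior (pprt (- u))"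
    by (intro quasi_interior_of_fixed pprt_fixed[OF \<phi>] zero_le_pprt ne)
  then have lim: "(\<lambda>n. inf (pprt u) (real n *\<^sub>R pprt (- u))) \<longlonglongrightarrow> pprt u"
    by (simp add: quasi_interior_def)
  have "inf (pprt u) (real n *\<^sub>R pprt (- u)) = 0" for n
  proof (cases n)
    case 0
    then show ?thesis by (simp add: inf_absorb2)
  next
    case (Suc k)
    have "inf (pprt u) (real n *\<^sub>R pprt (- u)) \<le> real n *\<^sub>R inf (pprt u) (pprt (- u))"
      using Suc by (intro inf_scaleR_le) simp_all
    then have "inf (pprt u) (real n *\<^sub>R pprt (- u)) \<le> 0" by (simp only: pprt_disjoint scaleR_zero_right)
    moreover have "0 \<le> inf (pprt u) (real n *\<^sub>R pprt (- u))"
      by (intro le_infI zero_le_pprt scaleR_nonneg_nonneg) simp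
    ultimately show ?thesis by (rule antisym)
  qed
  then have "(\<lambda>n::nat. 0) \<longlonglongrightarrow> pprt u" using lim by (simp only:)
  then show "pprt u = 0" by (simp only: LIMSEQ_const_iff)
qed

text \<open>Subtracting the multiple of \<open>u\<close> with the same value under
  \<open>\<phi>\<close> leaves a fixed vector \<open>w\<close> with \<open>\<phi> w = 0\<close>. It
  has one sign, so strict positivity makes it vanish.\<close>

lemma fixed_eq_multiple:
  assumes \<phi>: "\<phi> \<in> dual_gen_ker S" "strictly_pos_functional \<phi>"
    and u: "u \<in> gen_ker S" "0 \<le> u" "u \<noteq> 0" and v: "v \<in> gen_ker S"
  shows "v = (\<phi> v / \<phi> u) *\<^sub>R u"
proof -
  define w where "w = v + (- (\<phi> v / \<phi> u)) *\<^sub>R u"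
  have \<phi>u: "0 < \<phi> u" using \<phi>(2) u by (simp add: strictly_pos_functional_def)
  have w: "w \<in> gen_ker S" unfolding w_def by (intro gen_ker_add gen_ker_scaleR u v)
  have w0: "\<phi> w = 0" using \<phi>u by (simp add: w_def blinfun.diff_right blinfun.scaleR_right)
  have split: "\<phi> (pprt w) = \<phi> (pprt (- w))"
  proof -
    have "\<phi> (pprt w - pprt (- w)) = 0" by (simp only: pprt_diff_eq w0)
    then show ?thesis by (simp add: blinfun.diff_right)
  qed
  have zero: "x = 0" if "0 \<le> x" "\<phi> x = 0" for x
    using \<phi>(2) that unfolding strictly_pos_functional_def by (metis less_irrefl)
  have "pprt w = 0 \<and> pprt (- w) = 0"
    using fixed_sign[OF \<phi> w] split zero[OF zero_le_pprt, of w] zero[OF zero_le_pprt, of "- w"]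
    by (metis blinfun.zero_right)
  then have "w = 0" using pprt_diff_eq[of w] by simp
  then show ?thesis by (simp add: w_def)
qed

lemma exists_pos_fixed:
  assumes \<phi>: "\<phi> \<in> dual_gen_ker S" "strictly_pos_functional \<phi>" and v: "v \<in> gen_ker S" "v \<noteq> 0"
  obtains u where "u \<in> gen_ker S" "0 \<le> u" "u \<noteq> 0"
proof -
  have "modulus v \<noteq> 0" using v(2) norm_modulus[of v] by (metis norm_eq_zero)
  then show ?thesis using that[of "modulus v"] modulus_fixed[OF \<phi> v(1)] by simp
qed

text \<open>The limit operator \<open>P\<close> maps into the fixed space, and every fixed
  functional satisfies \<open>\<eta> f = \<eta> (P f)\<close>. As the fixed space is a line through
  \<open>u\<close>, the number \<open>\<eta> u\<close> determines \<open>\<eta>\<close>.\<close>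

lemma strongly_convergent_fixed:
  assumes \<phi>: "\<phi> \<in> dual_gen_ker S" "strictly_pos_functional \<phi>" "\<phi> \<noteq> 0" and conv: "strongly_convergent S"
  shows "gen_ker S \<noteq> {0}" "dual_gen_ker S \<subseteq> span {\<phi>}"
proof -
  obtain P where P: "\<And>f. ((\<lambda>t. S t f) \<longlongrightarrow> P f) at_top"
    using conv unfolding strongly_convergent_def by metis
  have fixed: "P f \<in> gen_ker S" for f
  proof -
    have "S t (P f) = P f" if t: "0 < t" for t
    proof -
      have "((\<lambda>s. S t (S s f)) \<longlongrightarrow> S t (P f)) at_top"
        using P by (rule bounded_linear.tendsto[OF blinfun.bounded_linear_right])
      moreover have "eventually (\<lambda>s. S t (S s f) = S (t + s) f) at_top"
        using eventually_gt_at_top[of 0] by eventually_elim (simp add: S_add t)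
      ultimately have "((\<lambda>s. S (t + s) f) \<longlongrightarrow> S t (P f)) at_top"
        by (rule Lim_transform_eventually)
      moreover have "((\<lambda>s. S (t + s) f) \<longlongrightarrow> P f) at_top"
        by (rule filterlim_compose[OF P filterlim_tendsto_add_at_top[OF tendsto_const filterlim_ident]])
      ultimately show ?thesis by (rule tendsto_unique[OF trivial_limit_at_top_linorder])
    qed
    then show ?thesis by (simp add: gen_ker_eq)
  qed
  obtain f0 where f0: "\<phi> f0 \<noteq> 0" using \<phi>(3) by (metis blinfun_eqI blinfun.zero_left)
  have "P f0 \<noteq> 0" using dual_fixed_tendsto[OF \<phi>(1) P, of f0] f0 by auto
  then show "gen_ker S \<noteq> {0}" using fixed[of f0] by auto
  obtain u where u: "u \<in> gen_ker S" "0 \<le> u" "u \<noteq> 0"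
    using exists_pos_fixed[OF \<phi>(1,2) fixed \<open>P f0 \<noteq> 0\<close>] by blast
  show "dual_gen_ker S \<subseteq> span {\<phi>}"
  proof
    fix \<eta> assume \<eta>: "\<eta> \<in> dual_gen_ker S"
    have "\<eta> f = ((\<eta> u / \<phi> u) *\<^sub>R \<phi>) f" for f
    proof -
      have "\<eta> f = \<eta> (P f)" by (rule dual_fixed_tendsto[OF \<eta> P])
      also have "P f = (\<phi> f / \<phi> u) *\<^sub>R u"
        using fixed_eq_multiple[OF \<phi>(1,2) u fixed, of f] dual_fixed_tendsto[OF \<phi>(1) P, of f] by simp
      finally show ?thesis by (simp add: blinfun.scaleR_right blinfun.scaleR_left)
    qed
    then have "\<eta> = (\<eta> u / \<phi> u) *\<^sub>R \<phi>" by (rule blinfun_eqI)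
    then show "\<eta> \<in> span {\<phi>}" by (metis span_base span_mul singletonI)
  qed
qed

text \<open>Once the component along \<open>u\<close> is removed, every fixed functional vanishes at
  the remainder \<open>g\<close>, being a multiple of \<open>\<phi>\<close>; a remainder that does
  not decay would be detected by one of them.\<close>

lemma tendsto_rank_one:
  assumes \<phi>: "\<phi> \<in> dual_gen_ker S" and one: "dual_gen_ker S = span {\<phi>}"
    and u: "u \<in> gen_ker S" "\<phi> u = 1"
  shows "((\<lambda>t. S t f) \<longlongrightarrow> \<phi> f *\<^sub>R u) at_top"
proof -
  define g where "g = f - \<phi> f *\<^sub>R u"
  have g0: "\<phi> g = 0" using u by (simp add: g_def blinfun.diff_right blinfun.scaleR_right)
  have "decays g"
  proof (rule ccontr)
    assume "\<not> decays g"
    then obtain \<psi> where "\<psi> \<in> dual_gen_ker S" "\<psi> g \<noteq> 0"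
      by (rule exists_pos_fixed_functional)
    then obtain c where "\<psi> = c *\<^sub>R \<phi>" using one by (auto simp: span_singleton)
    then show False using g0 \<open>\<psi> g \<noteq> 0\<close> by (simp add: blinfun.scaleR_left)
  qed
  then have "((\<lambda>t. S t g + \<phi> f *\<^sub>R u) \<longlongrightarrow> 0 + \<phi> f *\<^sub>R u) at_top"
    unfolding decays_def by (intro tendsto_add tendsto_const)
  moreover have "eventually (\<lambda>t. S t g + \<phi> f *\<^sub>R u = S t f) at_top"
    using eventually_gt_at_top[of 0]
    by eventually_elim (simp add: g_def blinfun.diff_right blinfun.scaleR_right fixedD[OF u(1)])
  ultimately show ?thesis by (auto dest: Lim_transform_eventually)
qed

end

theorem theorem3p6:
  fixes S :: "real \<Rightarrow> ('a::banach_lattice \<Rightarrow>\<^sub>L 'a)"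
  assumes "C0_semigroup S"
    and "positive_semigroup S"
    and "bounded_semigroup S"
    and "irreducible_semigroup S"
    and "eventually_norm_continuous S"
  shows "(edim (dual_gen_ker S) = 0 \<and>
            (\<forall>f. ((\<lambda>t. S t f) \<longlongrightarrow> 0) at_top))
       \<or> (edim (dual_gen_ker S) = 1 \<and> edim (gen_ker S) = 1 \<and>
            (\<exists>u \<phi>. quasi_interior u \<and> strictly_pos_functional \<phi> \<and>
               (\<forall>f. ((\<lambda>t. S t f) \<longlongrightarrow> \<phi> f *\<^sub>R u) at_top)))
       \<or> (edim (dual_gen_ker S) = 1 \<and> edim (gen_ker S) = 0 \<and>
            \<not> strongly_convergent S)
       \<or> (edim (dual_gen_ker S) \<ge> 2 \<and> \<not> strongly_convergent S)"
proof -
  obtain M where M: "\<And>t. 0 < t \<Longrightarrow> norm (S t) \<le> M"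
    using assms(3) by (auto simp: bounded_semigroup_def)
  interpret irreducible_bounded_semigroup S M
    using assms M by unfold_locales (auto simp: positive_semigroup_def)
  show ?thesis
  \<comment> \<open>The dimension conditions of the four alternatives exclude one another, so it
    remains to establish one of them.\<close>
  proof (cases "dual_gen_ker S = {0}")
    case True
    have "decays f" for f
    proof (rule ccontr)
      assume "\<not> decays f"
      then obtain \<psi> where "\<psi> \<in> dual_gen_ker S" "\<psi> f \<noteq> 0" by (rule exists_pos_fixed_functional)
      with True show False by simp
    qed
    then show ?thesis using True edim_zero by (auto simp: decays_def)
  next
    case False
    moreover have "0 \<in> dual_gen_ker S" by (simp add: dual_gen_ker_eq)
    ultimately obtain \<eta> where \<eta>: "\<eta> \<in> dual_gen_ker S" "\<eta> \<noteq> 0" by blast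
    then obtain f where f: "\<eta> f \<noteq> 0" by (metis blinfun_eqI blinfun.zero_left)
    \<comment> \<open>\<open>\<eta>\<close> carries no sign; it only exhibits a vector that does not
      decay, from which the Hahn-Banach construction produces a positive fixed functional.\<close>
    have "\<not> decays f"
      using dual_fixed_tendsto[OF \<eta>(1), of f 0] f by (auto simp: decays_def)
    then obtain \<phi> where \<phi>: "\<phi> \<in> dual_gen_ker S" "pos_functional \<phi>" "\<phi> f \<noteq> 0"
      by (rule exists_pos_fixed_functional)
    have \<phi>0: "\<phi> \<noteq> 0" using \<phi>(3) by auto
    have sp: "strictly_pos_functional \<phi>" by (rule strictly_pos_of_fixed[OF \<phi>(1,2) \<phi>0])
    have mult: "c *\<^sub>R \<phi> \<in> dual_gen_ker S" for c
      using \<phi>(1) by (simp add: dual_gen_ker_eq blinfun.scaleR_left)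
    show ?thesis
    proof (cases "dual_gen_ker S \<subseteq> span {\<phi>}")
      case True
      then have one: "dual_gen_ker S = span {\<phi>}" using mult by (auto simp: span_singleton)
      then have dim1: "edim (dual_gen_ker S) = 1" using edim_span_singleton[OF \<phi>0] by simp
      show ?thesis
      proof (cases "gen_ker S = {0}")
        case True
        then have "\<not> strongly_convergent S" using strongly_convergent_fixed(1)[OF \<phi>(1) sp \<phi>0] by blast
        with True dim1 edim_zero show ?thesis by auto
      next
        case False
        moreover have "0 \<in> gen_ker S" by (simp add: gen_ker_eq)
        ultimately obtain v where "v \<in> gen_ker S" "v \<noteq> 0" by blast
        then obtain u where u: "u \<in> gen_ker S" "0 \<le> u" "u \<noteq> 0" by (rule exists_pos_fixed[OF \<phi>(1) sp])
        have \<phi>u: "0 < \<phi> u" using sp u by (simp add: strictly_pos_functional_def)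
        have "gen_ker S \<subseteq> span {u}"
        proof
          fix v assume "v \<in> gen_ker S"
          then have "v = (\<phi> v / \<phi> u) *\<^sub>R u" by (rule fixed_eq_multiple[OF \<phi>(1) sp u])
          then show "v \<in> span {u}" unfolding span_singleton by (rule range_eqI)
        qed
        moreover have "span {u} \<subseteq> gen_ker S"
          using gen_ker_scaleR[OF u(1)] by (auto simp: span_singleton)
        ultimately have "gen_ker S = span {u}" by (rule antisym)
        then have dim1': "edim (gen_ker S) = 1" using edim_span_singleton[OF u(3)] by simp
        \<comment> \<open>Rescaled to the value 1 at \<open>u\<close>, as the rank one limit
          requires.\<close>
        define \<phi>' where "\<phi>' = inverse (\<phi> u) *\<^sub>R \<phi>"
        have "\<phi>' \<in> dual_gen_ker S" unfolding \<phi>'_def by (rule mult)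
        moreover have "dual_gen_ker S = span {\<phi>'}"
        proof -
          have "\<phi> = \<phi> u *\<^sub>R \<phi>'" using \<phi>u by (simp add: \<phi>'_def)
          then have "\<phi> \<in> span {\<phi>'}" by (metis span_base span_mul singletonI)
          moreover have "\<phi>' \<in> span {\<phi>}" unfolding \<phi>'_def using mult one by blast
          ultimately show ?thesis unfolding one span_eq by simp
        qed
        moreover have "\<phi>' u = 1" using \<phi>u by (simp add: \<phi>'_def blinfun.scaleR_left)
        ultimately have "((\<lambda>t. S t f) \<longlongrightarrow> \<phi>' f *\<^sub>R u) at_top" for f
          using u(1) by (intro tendsto_rank_one)
        moreover have "strictly_pos_functional \<phi>'"
          using sp \<phi>u by (simp add: strictly_pos_functional_def \<phi>'_def blinfun.scaleR_left)
        ultimately show ?thesis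
          using dim1 dim1' quasi_interior_of_fixed[OF u] by blast
      qed
    next
      case False
      then obtain \<zeta> where \<zeta>: "\<zeta> \<in> dual_gen_ker S" "\<zeta> \<notin> span {\<phi>}" by blast
      have "2 \<le> edim (dual_gen_ker S)" by (rule edim_ge_2[OF \<zeta>(1) \<phi>(1) \<zeta>(2) \<phi>0])
      moreover have "\<not> strongly_convergent S"
        using strongly_convergent_fixed(2)[OF \<phi>(1) sp \<phi>0] False by blast
      ultimately show ?thesis by blast
    qed
  qed
qed

end
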